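(* Let $K$ be an infinite field, $n\geq 2$, $S=K[x_1,\ldots,x_n]$. Let $I\subset S$ be an ideal of Borel type and let $e\geq \operatorname{reg}(I)$ be an integer. Then $I_{\geq e}$ is stable.
   Context: A monomial ideal $I\subset S$ is of Borel type if $(I:x_j^\infty)=(I:(x_1,\ldots,x_j)^\infty)$ for all $j=1,\ldots,n$. For a finitely generated graded $S$-module $M$, $\operatorname{reg}(M)=\max\{j-i : \beta_{ij}(M)\neq 0\}$ is the Castelnuovo-Mumford regularity, where $\beta_{ij}(M)$ are the graded Betti numbers. $I_{\geq e}$ denotes the ideal generated by the monomials of degree $\geq e$ belonging to $I$. For a monomial $u\neq 1$, $m(u)$ is the largest index $i$ with $x_i\mid u$. A monomial ideal $L$ is stable if for every monomial $u\in L$ (with $u\ne 1$) and every $j<m(u)$ one has $x_ju/x_{m(u)}\in L$. *)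

theory Defs
  imports
    "HOL-Library.Poly_Mapping"
    "HOL-Library.Extended_Real"
    "HOL-Library.Cardinality"
    "Jordan_Normal_Form.Matrix"
begin

section \<open>Polynomial rings and ideals\<close>

text \<open>Over a finite linearly ordered type \<open>'n\<close> of variables, \<open>('n, 'k) mpoly\<close> is the
  polynomial ring in \<open>CARD('n)\<close> variables; the order on \<open>'n\<close> is the order
  \<open>x\<^sub>1, \<dots>, x\<^sub>n\<close> of the variables. Monomials are represented by their exponent
  vectors.\<close>

type_synonym 'n monomial = "'n \<Rightarrow>\<^sub>0 nat"

type_synonym ('n, 'k) mpoly = "'n monomial \<Rightarrow>\<^sub>0 'k"

definition mon :: "'n monomial \<Rightarrow> ('n, 'k::field) mpoly" where
  "mon a = Poly_Mapping.single a 1"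

definition var :: "'n \<Rightarrow> ('n, 'k::field) mpoly" where
  "var i = mon (Poly_Mapping.single i 1)"

definition mdeg :: "'n monomial \<Rightarrow> nat" where
  "mdeg a = (\<Sum>i\<in>Poly_Mapping.keys a. Poly_Mapping.lookup a i)"

definition homogeneous :: "int \<Rightarrow> ('n, 'k::field) mpoly \<Rightarrow> bool" where
  "homogeneous d p \<longleftrightarrow> (\<forall>a\<in>Poly_Mapping.keys p. int (mdeg a) = d)"

abbreviation ideal_gen :: "'a::comm_ring_1 set \<Rightarrow> 'a set" where
  "ideal_gen \<equiv> Modules.module.span (*)"

primrec ideal_power :: "'a::comm_ring_1 set \<Rightarrow> nat \<Rightarrow> 'a set" where
  "ideal_power J 0 = UNIV"
| "ideal_power J (Suc k) = ideal_gen {a * b | a b. a \<in> J \<and> b \<in> ideal_power J k}"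

definition colon :: "'a::comm_ring_1 set \<Rightarrow> 'a set \<Rightarrow> 'a set" where
  "colon I J = {f. \<forall>g\<in>J. f * g \<in> I}"

definition saturation :: "'a::comm_ring_1 set \<Rightarrow> 'a set \<Rightarrow> 'a set" where
  "saturation I J = (\<Union>k. colon I (ideal_power J k))"

definition monomial_ideal :: "('n, 'k::field) mpoly set \<Rightarrow> bool" where
  "monomial_ideal I \<longleftrightarrow> (\<exists>A. I = ideal_gen (mon ` A))"

definition borel_type :: "('n::{finite,linorder}, 'k::field) mpoly set \<Rightarrow> bool" where
  "borel_type I \<longleftrightarrow> monomial_ideal I \<and>
     (\<forall>j. saturation I (ideal_gen {var j}) = saturation I (ideal_gen (var ` {..j})))"

definition truncation :: "('n, 'k::field) mpoly set \<Rightarrow> int \<Rightarrow> ('n, 'k) mpoly set" where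
  "truncation I e = ideal_gen {mon a | a. mon a \<in> I \<and> e \<le> int (mdeg a)}"

definition max_var :: "'n::{finite,linorder} monomial \<Rightarrow> 'n" where
  "max_var a = Max (Poly_Mapping.keys a)"

text \<open>For \<open>u = x\<^sup>a\<close>, the exponent vector of \<open>x\<^sub>j u / x\<^sub>m\<^sub>(\<^sub>u\<^sub>)\<close> is
  \<open>e\<^sub>j + (a - e\<^sub>m\<^sub>(\<^sub>u\<^sub>))\<close>; the subtraction is not truncated because
  \<open>x\<^sub>m\<^sub>(\<^sub>u\<^sub>)\<close> divides \<open>u\<close>.\<close>

definition stable :: "('n::{finite,linorder}, 'k::field) mpoly set \<Rightarrow> bool" where
  "stable L \<longleftrightarrow> monomial_ideal L \<and>
     (\<forall>a. a \<noteq> 0 \<longrightarrow> mon a \<in> L \<longrightarrow>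
        (\<forall>j < max_var a.
           mon (Poly_Mapping.single j 1 + (a - Poly_Mapping.single (max_var a) 1)) \<in> L))"

section \<open>Graded free resolutions, Betti numbers, regularity\<close>

text \<open>A graded module is given by a scalar multiplication \<open>scale\<close>, a carrier \<open>M\<close> and
  the family \<open>gr\<close> of its graded pieces. A graded free resolution
  \<open>\<dots> \<rightarrow> F\<^sub>1 \<rightarrow> F\<^sub>0 \<rightarrow> M \<rightarrow> 0\<close>
  by free modules of finite rank is encoded by the lists \<open>d i\<close> of the degrees of a homogeneous
  basis of \<open>F\<^sub>i\<close> (so \<open>F\<^sub>i\<close> is the direct sum of the \<open>S(- d i ! c)\<close>), the images \<open>g\<close> in
  \<open>M\<close> of the basis of \<open>F\<^sub>0\<close>, and the matrices \<open>\<phi> i\<close> of the maps from \<open>F\<^sub>i\<^sub>+\<^sub>1\<close> to \<open>F\<^sub>i\<close>.\<close>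

definition augmentation :: "('r \<Rightarrow> 'm::comm_monoid_add \<Rightarrow> 'm) \<Rightarrow> 'm list \<Rightarrow> 'r vec \<Rightarrow> 'm" where
  "augmentation scale g v = (\<Sum>k<length g. scale (v $ k) (g ! k))"

definition graded_free_resolution ::
  "(('n, 'k::field) mpoly \<Rightarrow> 'm::ab_group_add \<Rightarrow> 'm) \<Rightarrow> 'm set \<Rightarrow> (int \<Rightarrow> 'm set) \<Rightarrow>
   (nat \<Rightarrow> int list) \<Rightarrow> 'm list \<Rightarrow> (nat \<Rightarrow> ('n, 'k) mpoly mat) \<Rightarrow> bool" where
  "graded_free_resolution scale M gr d g \<phi> \<longleftrightarrow>
     length g = length (d 0) \<and>
     (\<forall>k < length g. g ! k \<in> gr (d 0 ! k)) \<and>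
     (\<forall>i. \<phi> i \<in> carrier_mat (length (d i)) (length (d (Suc i)))) \<and>
     (\<forall>i. \<forall>r < length (d i). \<forall>c < length (d (Suc i)).
        homogeneous (d (Suc i) ! c - d i ! r) (\<phi> i $$ (r, c))) \<and>
     augmentation scale g ` carrier_vec (length (d 0)) = M \<and>
     (\<lambda>w. \<phi> 0 *\<^sub>v w) ` carrier_vec (length (d 1)) =
       {v \<in> carrier_vec (length (d 0)). augmentation scale g v = 0} \<and>
     (\<forall>i. (\<lambda>w. \<phi> (Suc i) *\<^sub>v w) ` carrier_vec (length (d (Suc (Suc i)))) =
       {v \<in> carrier_vec (length (d (Suc i))). \<phi> i *\<^sub>v v = 0\<^sub>v (length (d i))})"

text \<open>Minimality: the image of \<open>F\<^sub>i\<^sub>+\<^sub>1\<close> lies in \<open>\<mm> F\<^sub>i\<close>, where \<open>\<mm>\<close> is the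
  ideal generated by the variables; equivalently, all matrix entries lie in \<open>\<mm>\<close>.\<close>

definition minimal_graded_free_resolution ::
  "(('n, 'k::field) mpoly \<Rightarrow> 'm::ab_group_add \<Rightarrow> 'm) \<Rightarrow> 'm set \<Rightarrow> (int \<Rightarrow> 'm set) \<Rightarrow>
   (nat \<Rightarrow> int list) \<Rightarrow> 'm list \<Rightarrow> (nat \<Rightarrow> ('n, 'k) mpoly mat) \<Rightarrow> bool" where
  "minimal_graded_free_resolution scale M gr d g \<phi> \<longleftrightarrow>
     graded_free_resolution scale M gr d g \<phi> \<and>
     (\<forall>i. \<forall>r < length (d i). \<forall>c < length (d (Suc i)).
        \<phi> i $$ (r, c) \<in> ideal_gen (range var))"

text \<open>\<open>\<beta>\<^sub>i\<^sub>j(M)\<close> is the number of copies of \<open>S(-j)\<close> in \<open>F\<^sub>i\<close> for a minimal graded free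
  resolution of \<open>M\<close>; such a resolution exists for every finitely generated graded module and is
  unique up to isomorphism, so the choice is immaterial.\<close>

definition betti ::
  "(('n, 'k::field) mpoly \<Rightarrow> 'm::ab_group_add \<Rightarrow> 'm) \<Rightarrow> 'm set \<Rightarrow> (int \<Rightarrow> 'm set) \<Rightarrow>
   nat \<Rightarrow> int \<Rightarrow> nat" where
  "betti scale M gr i j =
     count_list ((SOME d. \<exists>g \<phi>. minimal_graded_free_resolution scale M gr d g \<phi>) i) j"

text \<open>The maximum is written as a supremum in the extended reals, in which it is attained whenever
  \<open>M\<close> is nonzero and finitely generated; the zero module gets regularity \<open>-\<infinity>\<close>.\<close>

definition reg ::
  "(('n, 'k::field) mpoly \<Rightarrow> 'm::ab_group_add \<Rightarrow> 'm) \<Rightarrow> 'm set \<Rightarrow> (int \<Rightarrow> 'm set) \<Rightarrow> ereal" where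
  "reg scale M gr =
     Sup {ereal (real_of_int (j - int i)) | i j. betti scale M gr i j \<noteq> 0}"

definition ideal_reg :: "('n, 'k::field) mpoly set \<Rightarrow> ereal" where
  "ideal_reg I = reg (*) I (\<lambda>d. {f \<in> I. homogeneous d f})"

end

theory Submission
  imports Defs
begin

text \<open>
  Let \<open>u \<in> I\<close> be a monomial of degree at least \<open>e\<close>, \<open>m = m(u)\<close>, \<open>j < m\<close>, and suppose that
  \<open>v = x\<^sub>j u / x\<^sub>m\<close> is not in \<open>I\<close>. Since \<open>u / x\<^sub>m\<close> is in \<open>I : x\<^sub>m\<^sup>\<infinity>\<close>, it is in
  \<open>I : (x\<^sub>1, \<dots>, x\<^sub>m)\<^sup>\<infinity>\<close> by the Borel type property, and so is \<open>v\<close>. Hence among the multiples of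
  \<open>v\<close> by monomials in \<open>x\<^sub>1, \<dots>, x\<^sub>m\<close> outside of \<open>I\<close> there is one of maximal degree, a monomial
  \<open>w \<notin> I\<close> in \<open>x\<^sub>1, \<dots>, x\<^sub>m\<close> with \<open>x\<^sub>i w \<in> I\<close> for all \<open>i \<le> m\<close> and \<open>deg w \<ge> e\<close>
  (\<open>socle_multiple_exists\<close>).

  Such a monomial gives the class of \<open>w e\<^sub>1 \<and> \<dots> \<and> e\<^sub>m\<close> in the Koszul homology of \<open>S/I\<close>, a nonzero
  element of \<open>Tor\<^sub>m(S/I, K) = Tor\<^sub>m\<^sub>-\<^sub>1(I, K)\<close> of degree \<open>deg w + m\<close>. Therefore
  \<open>reg I \<ge> deg w + m - (m - 1) > e\<close>, a contradiction. Instead of \<open>Tor\<close> and its balancing, a diagram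
  chase in the double complex of an arbitrary graded free resolution of \<open>S/I\<close> and the Koszul complex
  is used (\<open>koszul_chase\<close>, \<open>resolution_degree_ge_socle\<close>): if all basis elements of the \<open>m\<close>-th free
  module had degree less than \<open>deg w + m\<close>, the cycle would be a boundary. The chase needs only that
  the Koszul complex of the polynomial ring is exact (\<open>koszul_exact\<close>), which is seen in each
  multidegree, where it is the chain complex of a simplex.

  The Betti numbers are defined by the choice of a minimal graded free resolution, so it has to be
  shown that there is one (\<open>minimal_resolution_exists\<close>); then the bound on the regularity bounds the
  degrees of the chosen one. For a monomial ideal there is a multigraded minimal resolution.
  In each multidegree its matrices are matrices of scalars, and the finite generation of its syzygies
  is linear algebra over the field together with the finiteness of the set of least common multiples
  of finitely many monomials. Only the ideal itself needs Dickson's lemma.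
\<close>

abbreviation lookup :: "('a \<Rightarrow>\<^sub>0 'b::zero) \<Rightarrow> 'a \<Rightarrow> 'b" where
  "lookup \<equiv> Poly_Mapping.lookup"

abbreviation keys :: "('a \<Rightarrow>\<^sub>0 'b::zero) \<Rightarrow> 'a set" where
  "keys \<equiv> Poly_Mapping.keys"

abbreviation single :: "'a \<Rightarrow> 'b \<Rightarrow> 'a \<Rightarrow>\<^sub>0 'b::zero" where
  "single \<equiv> Poly_Mapping.single"

section \<open>Divisibility and degree of monomials\<close>

text \<open>The exponent vector of the variable \<open>x\<^sub>i\<close>.\<close>

definition expo :: "'n \<Rightarrow> 'n monomial" where
  "expo i = single i 1"

lemma lookup_expo: "lookup (expo i) j = (if i = j then 1 else 0)"
  by (simp add: expo_def lookup_single when_def)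

lemma keys_expo [simp]: "keys (expo i) = {i}"
  by (simp add: expo_def)

text \<open>Divisibility of monomials, in terms of exponent vectors. The order that
  \<open>'n monomial\<close> carries as a type is the lexicographic one.\<close>

definition mdvd :: "'n monomial \<Rightarrow> 'n monomial \<Rightarrow> bool" where
  "mdvd a b \<longleftrightarrow> (\<exists>c. b = a + c)"

lemma mdvd_iff: "mdvd a b \<longleftrightarrow> (\<forall>i. lookup a i \<le> lookup b i)"
proof
  assume "\<forall>i. lookup a i \<le> lookup b i"
  then have "b = a + (b - a)"
    by (intro poly_mapping_eqI) (simp add: lookup_add lookup_minus)
  then show "mdvd a b" unfolding mdvd_def by blast
qed (auto simp: mdvd_def lookup_add)

lemma mdvd_refl [simp]: "mdvd a a"
  and mdvd_zero [simp]: "mdvd 0 a"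
  and mdvd_add_left [simp]: "mdvd a (a + b)"
  and mdvd_add_right [simp]: "mdvd b (a + b)"
  by (auto simp: mdvd_iff lookup_add)

lemma mdvd_trans: "mdvd a b \<Longrightarrow> mdvd b c \<Longrightarrow> mdvd a c"
  by (auto simp: mdvd_iff intro: order_trans)

lemma mdvd_minus_add: "mdvd a b \<Longrightarrow> a + (b - a) = b"
  by (auto simp: mdvd_def)

lemma mdvd_expo_iff: "mdvd (expo i) a \<longleftrightarrow> 0 < lookup a i"
  by (auto simp: mdvd_iff lookup_expo Suc_le_eq split: if_splits)

lemma monomial_nonzeroE:
  assumes "(a :: 'n monomial) \<noteq> 0"
  obtains i where "0 < lookup a i"
  using assms by (metis gr0I lookup_zero poly_mapping_eqI)

lemma mdeg_eq_sum_UNIV: "mdeg a = (\<Sum>i\<in>UNIV. lookup a (i :: 'n :: finite))"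
  unfolding mdeg_def by (intro sum.mono_neutral_left) (auto simp: in_keys_iff)

lemma mdeg_add: "mdeg (a + b) = mdeg a + mdeg (b :: ('n :: finite) monomial)"
  by (simp add: mdeg_eq_sum_UNIV lookup_add sum.distrib)

lemma mdeg_expo [simp]: "mdeg (expo i) = 1"
  by (simp add: mdeg_def lookup_expo)

lemma mdeg_zero [simp]: "mdeg 0 = 0"
  by (simp add: mdeg_def)

lemma mdvd_mdeg_le: "mdvd a b \<Longrightarrow> mdeg a \<le> mdeg (b :: ('n :: finite) monomial)"
  by (auto simp: mdvd_def mdeg_add)

section \<open>Coefficients of products\<close>

lemma poly_eq_sum_single: "p = (\<Sum>a\<in>keys p. single a (lookup p a))"
  by (rule poly_mapping_eqI)
    (simp add: lookup_sum lookup_single when_def in_keys_iff)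

lemma lookup_single_mult:
  fixes p :: "('n, 'k::field) mpoly"
  shows "lookup (single b c * p) a = (if mdvd b a then c * lookup p (a - b) else 0)"
proof -
  have "single b c * p = (\<Sum>a\<in>keys p. single (b + a) (c * lookup p a))"
    by (subst (1) poly_eq_sum_single[of p]) (simp add: sum_distrib_left mult_single)
  then have *: "lookup (single b c * p) a = (\<Sum>a'\<in>keys p. c * lookup p a' when b + a' = a)"
    by (simp add: lookup_sum lookup_single)
  show ?thesis
  proof (cases "mdvd b a")
    case True
    then obtain d where "a = b + d" by (auto simp: mdvd_def)
    then show ?thesis using * by (simp add: when_def in_keys_iff)
  next
    case False
    then show ?thesis using * by (auto simp: mdvd_def when_def intro!: sum.neutral)
  qed
qed

lemma var_eq_mon: "var i = mon (expo i)"
  by (simp add: var_def expo_def)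

lemma lookup_var_mult:
  "lookup (var j * p) a = (if 0 < lookup a j then lookup p (a - expo j) else 0)"
  by (simp add: var_eq_mon mon_def lookup_single_mult mdvd_expo_iff)

lemma mon_mult: "mon a * mon b = mon (a + b)"
  by (simp add: mon_def mult_single)

lemma keys_mon [simp]: "keys (mon a :: ('n, 'k::field) mpoly) = {a}"
  by (simp add: mon_def)

lemma mon_eq_iff [simp]: "(mon a :: ('n, 'k::field) mpoly) = mon b \<longleftrightarrow> a = b"
  by (metis keys_mon singleton_inject)

subsection \<open>Homogeneous parts\<close>

text \<open>The homogeneous component of degree \<open>d\<close>.\<close>

definition hpart :: "int \<Rightarrow> ('n, 'k::field) mpoly \<Rightarrow> ('n, 'k) mpoly" where
  "hpart d p = Abs_poly_mapping (\<lambda>a. lookup p a when int (mdeg a) = d)"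

lemma lookup_hpart: "lookup (hpart d p) a = (if int (mdeg a) = d then lookup p a else 0)"
proof -
  have "finite {a. (lookup p a when int (mdeg a) = d) \<noteq> 0}"
    by (rule finite_subset[OF _ finite_keys[of p]]) (auto simp: in_keys_iff when_def)
  then show ?thesis by (simp add: hpart_def when_def)
qed

lemma homogeneous_iff: "homogeneous d p \<longleftrightarrow> (\<forall>a. lookup p a \<noteq> 0 \<longrightarrow> int (mdeg a) = d)"
  by (auto simp: homogeneous_def in_keys_iff)

lemma homogeneous_hpart: "homogeneous d (hpart d p)"
  by (auto simp: homogeneous_iff lookup_hpart split: if_splits)

lemma hpart_homogeneous: "homogeneous d p \<Longrightarrow> hpart d p = p"
  by (rule poly_mapping_eqI) (auto simp: homogeneous_iff lookup_hpart)

lemma hpart_sum: "hpart d (\<Sum>i\<in>X. f i) = (\<Sum>i\<in>X. hpart d (f i))"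
  by (rule poly_mapping_eqI) (simp add: lookup_hpart lookup_sum)

lemma hpart_mult:
  fixes p q :: "('n::finite, 'k::field) mpoly"
  assumes "homogeneous k p"
  shows "hpart d (p * q) = p * hpart (d - k) q"
proof -
  have *: "hpart d (single a c * q) = single a c * hpart (d - k) q"
    if "int (mdeg a) = k" for a and c :: 'k
  proof (rule poly_mapping_eqI)
    fix m
    have "mdeg m = mdeg a + mdeg (m - a)" if "mdvd a m"
      using mdvd_minus_add[OF that] mdeg_add[of a "m - a"] by simp
    then show "lookup (hpart d (single a c * q)) m = lookup (single a c * hpart (d - k) q) m"
      using that by (auto simp: lookup_hpart lookup_single_mult)
  qed
  have "p * q = (\<Sum>a\<in>keys p. single a (lookup p a) * q)"
    by (subst poly_eq_sum_single[of p]) (simp add: sum_distrib_right)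
  then have "hpart d (p * q) = (\<Sum>a\<in>keys p. single a (lookup p a) * hpart (d - k) q)"
    using assms by (simp add: hpart_sum * homogeneous_def)
  also have "\<dots> = p * hpart (d - k) q"
    by (subst (3) poly_eq_sum_single[of p]) (simp add: sum_distrib_right)
  finally show ?thesis .
qed

lemma homogeneous_mult:
  fixes p q :: "('n::finite, 'k::field) mpoly"
  assumes "homogeneous k p" "homogeneous l q"
  shows "homogeneous (k + l) (p * q)"
  using hpart_mult[OF assms(1), of "k + l" q] homogeneous_hpart[of "k + l" "p * q"] 
    hpart_homogeneous[OF assms(2)] by simp

lemma homogeneous_var: "homogeneous 1 (var j)"
  by (simp add: homogeneous_def var_eq_mon)

lemma homogeneous_zero [simp]: "homogeneous d 0"
  by (simp add: homogeneous_def)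

lemma homogeneous_sum: "(\<And>i. i \<in> X \<Longrightarrow> homogeneous d (f i)) \<Longrightarrow> homogeneous d (\<Sum>i\<in>X. f i)"
  by (metis (no_types, lifting) hpart_homogeneous hpart_sum homogeneous_hpart sum.cong)

section \<open>Monomial ideals\<close>

lemma module_mult: "Modules.module ((*) :: 'a::comm_ring_1 \<Rightarrow> 'a \<Rightarrow> 'a)"
  by unfold_locales (simp_all add: algebra_simps)

lemmas ideal_gen_base = Modules.module.span_base[OF module_mult]
  and ideal_gen_zero = Modules.module.span_zero[OF module_mult]
  and ideal_gen_add = Modules.module.span_add[OF module_mult]
  and ideal_gen_scale = Modules.module.span_scale[OF module_mult]
  and ideal_gen_sum = Modules.module.span_sum[OF module_mult]
  and ideal_gen_induct [consumes 1, case_names base step] =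
    Modules.module.span_induct_alt[OF module_mult]
  and ideal_gen_finite = Modules.module.span_finite[OF module_mult]

lemma mem_monomial_ideal_iff:
  fixes f :: "('n, 'k::field) mpoly"
  shows "f \<in> ideal_gen (mon ` A) \<longleftrightarrow> (\<forall>a\<in>keys f. \<exists>b\<in>A. mdvd b a)"
proof
  assume "f \<in> ideal_gen (mon ` A)"
  then show "\<forall>a\<in>keys f. \<exists>b\<in>A. mdvd b a"
  proof (induction rule: ideal_gen_induct)
    case base
    then show ?case by simp
  next
    case (step c x y)
    then obtain b where b: "b \<in> A" "x = mon b" by auto
    show ?case
    proof
      fix a assume a: "a \<in> keys (c * x + y)"
      show "\<exists>b\<in>A. mdvd b a"
      proof (cases "a \<in> keys y")
        case False
        with a have "lookup (single b 1 * c) a \<noteq> 0"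
          by (simp add: in_keys_iff lookup_add b mon_def mult.commute)
        then have "mdvd b a" by (auto simp: lookup_single_mult split: if_splits)
        with b show ?thesis by blast
      qed (use step in blast)
    qed
  qed
next
  assume *: "\<forall>a\<in>keys f. \<exists>b\<in>A. mdvd b a"
  have "single a (lookup f a) \<in> ideal_gen (mon ` A)" if "a \<in> keys f" for a
  proof -
    from * that obtain b c where b: "b \<in> A" "a = b + c" by (auto simp: mdvd_def)
    then have "single a (lookup f a) = single c (lookup f a) * mon b"
      by (simp add: mon_def mult_single add.commute)
    then show ?thesis using b by (auto intro: ideal_gen_scale ideal_gen_base)
  qed
  then have "(\<Sum>a\<in>keys f. single a (lookup f a)) \<in> ideal_gen (mon ` A)"
    by (rule ideal_gen_sum)
  then show "f \<in> ideal_gen (mon ` A)" by (simp flip: poly_eq_sum_single)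
qed

lemma mon_mem_monomial_ideal_iff:
  "(mon a :: ('n, 'k::field) mpoly) \<in> ideal_gen (mon ` A) \<longleftrightarrow> (\<exists>b\<in>A. mdvd b a)"
  by (simp add: mem_monomial_ideal_iff)

lemma monomial_ideal_mem_iff:
  assumes "monomial_ideal I"
  shows "f \<in> I \<longleftrightarrow> (\<forall>a\<in>keys f. mon a \<in> I)"
  using assms by (auto simp: monomial_ideal_def mem_monomial_ideal_iff)

lemma monomial_ideal_mon_mdvd:
  assumes "monomial_ideal I" "mon a \<in> I" "mdvd a b"
  shows "mon b \<in> I"
  using assms unfolding monomial_ideal_def
  by (metis mon_mem_monomial_ideal_iff mdvd_trans)

section \<open>The Koszul complex\<close>

text \<open>A chain of the Koszul complex of \<open>x\<^sub>1, \<dots>, x\<^sub>n\<close> is a family of polynomials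
  indexed by sets \<open>J\<close> of variables, \<open>f J\<close> being the coefficient of
  \<open>e\<^sub>J = \<and>\<^sub>j\<^sub>\<in>\<^sub>J e\<^sub>j\<close>. The sign of \<open>e\<^sub>J\<close> in the boundary of
  \<open>e\<^sub>J\<^sub>\<union>\<^sub>{\<^sub>j\<^sub>}\<close> is determined by the number of elements of \<open>J\<close> below \<open>j\<close>.\<close>

definition koszul_sign :: "'n::{finite,linorder} \<Rightarrow> 'n set \<Rightarrow> ('n, 'k::field) mpoly" where
  "koszul_sign j J = (-1) ^ card {i\<in>J. i < j}"

definition koszul_bd ::
  "('n::{finite,linorder} set \<Rightarrow> ('n, 'k::field) mpoly) \<Rightarrow> 'n set \<Rightarrow> ('n, 'k) mpoly" where
  "koszul_bd f J = (\<Sum>j\<in>- J. koszul_sign j J * (var j * f (insert j J)))"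

lemma koszul_sign_insert:
  assumes "j \<notin> J"
  shows "koszul_sign k (insert j J) = (if j < k then - koszul_sign k J else koszul_sign k J)"
proof -
  have "{i \<in> insert j J. i < k} = (if j < k then insert j {i\<in>J. i < k} else {i\<in>J. i < k})"
    by auto
  then show ?thesis using assms by (simp add: koszul_sign_def)
qed

lemma koszul_bd_bd: "koszul_bd (koszul_bd f) J = 0"
proof -
  define t where "t j k = koszul_sign j J * (var j * (koszul_sign k (insert j J) *
    (var k * f (insert k (insert j J)))))" for j k
  define P where "P = {p \<in> (- J) \<times> (- J). fst p < snd p}"
  have anti: "t k j = - t j k" if "j < k" "j \<notin> J" "k \<notin> J" for j k
    using that by (simp add: t_def koszul_sign_insert insert_commute algebra_simps)
  have "koszul_bd (koszul_bd f) J = (\<Sum>j\<in>- J. \<Sum>k\<in>- insert j J. t j k)"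
    by (simp add: koszul_bd_def t_def sum_distrib_left)
  also have "\<dots> = (\<Sum>p\<in>(SIGMA j:- J. - insert j J). t (fst p) (snd p))"
    by (simp add: sum.Sigma split_beta)
  also have "(SIGMA j:- J. - insert j J) = P \<union> prod.swap ` P"
    proof (intro equalityI subsetI)
    fix p assume "p \<in> (SIGMA j:- J. - insert j J)"
    then have "p \<in> P \<or> prod.swap p \<in> P" by (cases p) (auto simp: P_def)
    then show "p \<in> P \<union> prod.swap ` P" by (metis UnCI image_eqI swap_swap)
  qed (auto simp: P_def)
  also have "(\<Sum>p\<in>P \<union> prod.swap ` P. t (fst p) (snd p)) =
      (\<Sum>p\<in>P. t (fst p) (snd p)) + (\<Sum>p\<in>prod.swap ` P. t (fst p) (snd p))"
    by (rule sum.union_disjoint) (auto simp: P_def)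
  also have "(\<Sum>p\<in>prod.swap ` P. t (fst p) (snd p)) = (\<Sum>p\<in>P. t (snd p) (fst p))"
    by (subst sum.reindex) simp_all
  also have "\<dots> = (\<Sum>p\<in>P. - t (fst p) (snd p))"
    by (rule sum.cong) (auto simp: P_def intro: anti)
  finally show ?thesis by (simp add: sum_negf)
qed

lemma koszul_bd_diff: "koszul_bd (\<lambda>J. f J - g J) J = koszul_bd f J - koszul_bd g J"
  by (simp add: koszul_bd_def algebra_simps sum_subtractf)

lemma koszul_bd_linear:
  "koszul_bd (\<lambda>J. \<Sum>c\<in>X. p c * f c J) J = (\<Sum>c\<in>X. p c * koszul_bd (f c) J)"
  unfolding koszul_bd_def sum_distrib_left
  by (subst sum.swap) (simp add: algebra_simps)

lemma koszul_bd_cong: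
  assumes "\<And>J'. card J' = Suc (card J) \<Longrightarrow> f J' = g J'"
  shows "koszul_bd f J = koszul_bd g J"
  unfolding koszul_bd_def using assms by (intro sum.cong) auto

lemma homogeneous_koszul_bd:
  assumes "\<And>J'. card J' = Suc (card J) \<Longrightarrow> homogeneous d (f J')"
  shows "homogeneous (1 + d) (koszul_bd f J)"
proof -
  have "homogeneous (0 + (1 + d)) (koszul_sign j J * (var j * f (insert j J)))" if "j \<in> - J" for j
  proof (intro homogeneous_mult homogeneous_var assms)
    have "koszul_sign j J = (1 :: ('a, 'b) mpoly) \<or> koszul_sign j J = (- 1 :: ('a, 'b) mpoly)"
      unfolding koszul_sign_def using neg_one_even_power neg_one_odd_power by blast
    then show "homogeneous 0 (koszul_sign j J :: ('a, 'b) mpoly)"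
      by (auto simp: homogeneous_def)
  qed (use that in auto)
  then show ?thesis unfolding koszul_bd_def by (intro homogeneous_sum) simp
qed

subsection \<open>Exactness\<close>

text \<open>The contraction: the monomial element \<open>x\<^sup>a e\<^sub>J\<close> has the multidegree
  \<open>b = a + \<Sum>\<^sub>j\<^sub>\<in>\<^sub>J e\<^sub>j\<close>, and the elements of multidegree \<open>b\<close> form the chain
  complex of a full simplex on the support of \<open>b\<close>. If \<open>k\<close> is the least variable of this
  support, the contraction to the vertex \<open>k\<close> sends \<open>x\<^sup>a e\<^sub>J\<close> to
  \<open>x\<^sup>a x\<^sub>k\<^sup>-\<^sup>1 e\<^sub>k \<and> e\<^sub>J\<close> if \<open>k \<notin> J\<close> and to \<open>0\<close>
  otherwise. It is linear over the field only.\<close>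

definition koszul_cone ::
  "('n::{finite,linorder} set \<Rightarrow> ('n, 'k::field) mpoly) \<Rightarrow> 'n set \<Rightarrow> ('n, 'k) mpoly" where
  "koszul_cone f J = Abs_poly_mapping (\<lambda>a.
     lookup (f (J - {Min (J \<union> keys a)})) (a + expo (Min (J \<union> keys a))) when
       Min (J \<union> keys a) \<in> J)"

lemma lookup_koszul_cone:
  "lookup (koszul_cone f J) a = (if Min (J \<union> keys a) \<in> J
     then lookup (f (J - {Min (J \<union> keys a)})) (a + expo (Min (J \<union> keys a))) else 0)"
proof -
  let ?g = "\<lambda>a. lookup (f (J - {Min (J \<union> keys a)})) (a + expo (Min (J \<union> keys a))) when
       Min (J \<union> keys a) \<in> J"
  have "{a. ?g a \<noteq> 0} \<subseteq> (\<Union>k. (\<lambda>b. b - expo k) ` keys (f (J - {k})))"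
  proof (intro subsetI)
    fix a assume "a \<in> {a. ?g a \<noteq> 0}"
    then have "a + expo (Min (J \<union> keys a)) \<in> keys (f (J - {Min (J \<union> keys a)}))"
      by (simp add: in_keys_iff when_def split: if_splits)
    then show "a \<in> (\<Union>k. (\<lambda>b. b - expo k) ` keys (f (J - {k})))"
      by (intro UN_I[where a = "Min (J \<union> keys a)", OF UNIV_I] 
          image_eqI[where x = "a + expo (Min (J \<union> keys a))"]) simp_all
  qed
  then have "finite {a. ?g a \<noteq> 0}" by (rule finite_subset) auto
  then show ?thesis by (simp add: koszul_cone_def when_def)
qed

lemma lookup_koszul_sign_mult:
  fixes p :: "('n::{finite,linorder}, 'k::field) mpoly"
  shows "lookup (koszul_sign j J * p) a = (-1) ^ card {i\<in>J. i < j} * lookup p a"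
  by (cases "even (card {i\<in>J. i < j})") (simp_all add: koszul_sign_def)

lemma lookup_koszul_bd:
  "lookup (koszul_bd f J) a = (\<Sum>j\<in>keys a - J. (-1) ^ card {i\<in>J. i < j} *
     lookup (f (insert j J)) (a - expo j))"
  unfolding koszul_bd_def lookup_sum
  by (intro sum.mono_neutral_cong_right)
    (auto simp: lookup_koszul_sign_mult lookup_var_mult in_keys_iff)

text \<open>The contraction \<open>h\<close> satisfies \<open>\<partial>h + h\<partial> = id\<close> in all multidegrees except zero, where
  there is only the constant term of the coefficient of \<open>e\<^sub>\<emptyset>\<close>. The component of this identity at
  \<open>e\<^sub>J\<close> involves the boundary of \<open>f\<close> only at sets with one element less.\<close>

lemma koszul_exact:
  fixes f :: "'n::{finite,linorder} set \<Rightarrow> ('n, 'k::field) mpoly"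
  assumes cycle: "\<And>J'. Suc (card J') = card J \<Longrightarrow> koszul_bd f J' = 0"
    and const: "J = {} \<Longrightarrow> lookup (f J) 0 = 0"
  shows "f J = koszul_bd (koszul_cone f) J"
proof (rule poly_mapping_eqI)
  fix a :: "'n monomial"
  show "lookup (f J) a = lookup (koszul_bd (koszul_cone f) J) a"
  proof (cases "J = {} \<and> a = 0")
    case True
    then show ?thesis using const by (simp add: lookup_koszul_bd)
  next
    case False
    define k where "k = Min (J \<union> keys a)"
    from False have ne: "J \<union> keys a \<noteq> {}" by auto
    then have k: "k \<in> J \<union> keys a"
      unfolding k_def by (intro Min_in) simp_all
    have k_le: "k \<le> i" if "i \<in> J \<union> keys a" for i
      unfolding k_def using that by (intro Min_le) simp_all
    \<comment> \<open>Moving a variable from the monomial to the exterior part keeps the multidegree.\<close>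
    have shift: "insert j J \<union> keys (a - expo j) = J \<union> keys a" if "j \<in> keys a" for j
      using that by (auto simp: in_keys_iff lookup_minus lookup_expo split: if_splits)
    have "lookup (koszul_bd (koszul_cone f) J) a = 
      (\<Sum>j\<in>keys a - J. (-1) ^ card {i\<in>J. i < j} * (if k \<in> insert j J 
        then lookup (f (insert j J - {k})) (a - expo j + expo k) else 0))"
      unfolding lookup_koszul_bd lookup_koszul_cone
      by (intro sum.cong refl) (use shift in \<open>simp flip: k_def\<close>)
    note cone = this
    show ?thesis
    proof (cases "k \<in> J")
      case False
      with k have ka: "k \<in> keys a" by auto
      then have mk: "a - expo k + expo k = a"
        by (intro poly_mapping_eqI) (auto simp: lookup_add lookup_minus lookup_expo in_keys_iff)
      have "{i\<in>J. i < k} = {}" using k_le by force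
      then have sgn: "(-1) ^ card {i\<in>J. i < k} = (1 :: 'k)" by (simp only: card.empty power_0)
      have "lookup (koszul_bd (koszul_cone f) J) a = 
        (\<Sum>j\<in>keys a - J. if j = k then lookup (f J) a else 0)"
        unfolding cone
        by (intro sum.cong refl) (use False mk sgn in auto)
      then show ?thesis using ka False by simp
    next
      case True
      define J' where "J' = J - {k}"
      have J: "J = insert k J'" "k \<notin> J'" using True by (auto simp: J'_def)
      have "{i\<in>J'. i < k} = {}" using k_le J by force
      then have sgn_k: "(-1) ^ card {i\<in>J'. i < k} = (1 :: 'k)" by (simp only: card.empty power_0)
      have keys: "keys (a + expo k) - J' = insert k (keys a - J)"
        using J by (auto simp: in_keys_iff lookup_add lookup_expo)
      have sgn: "(-1) ^ card {i\<in>J'. i < j} = - ((-1) ^ card {i\<in>J. i < j} :: 'k)"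
        if "j \<in> keys a - J" for j
      proof -
        have "k < j" using k_le[of j] that True by (cases "j = k") auto
        then have "{i\<in>J. i < j} = insert k {i\<in>J'. i < j}" using J by auto
        then show ?thesis using J by simp
      qed
      have mj: "a + expo k - expo j = a - expo j + expo k" if "j \<in> keys a" for j
        using that
        by (intro poly_mapping_eqI) (auto simp: lookup_add lookup_minus lookup_expo in_keys_iff)
      have "0 = lookup (koszul_bd f J') (a + expo k)"
        using cycle[of J'] J by simp
      also have "\<dots> = lookup (f J) a + (\<Sum>j\<in>keys a - J. (-1) ^ card {i\<in>J'. i < j} *
          lookup (f (insert j J')) (a + expo k - expo j))"
        unfolding lookup_koszul_bd keys using True J sgn_k
        by (subst sum.insert) auto
      also have "(\<Sum>j\<in>keys a - J. (-1) ^ card {i\<in>J'. i < j} *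
          lookup (f (insert j J')) (a + expo k - expo j)) =
        - lookup (koszul_bd (koszul_cone f) J) a"
        unfolding cone sum_negf[symmetric]
      proof (intro sum.cong refl)
        fix j assume j: "j \<in> keys a - J"
        then have "insert j J' = insert j J - {k}" using True by (auto simp: J'_def)
        then show "(-1) ^ card {i\<in>J'. i < j} * lookup (f (insert j J')) (a + expo k - expo j) =
          - ((-1) ^ card {i\<in>J. i < j} * (if k \<in> insert j J 
            then lookup (f (insert j J - {k})) (a - expo j + expo k) else 0))"
          using j True sgn[OF j] mj by simp
      qed
      finally show ?thesis by simp
    qed
  qed
qed

section \<open>Socle elements and the degrees of a resolution\<close>

text \<open>An exact complex \<open>\<dots> \<rightarrow> G\<^sub>1 \<rightarrow> G\<^sub>0\<close> of graded free modules: \<open>rk q\<close> is the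
  rank of \<open>G\<^sub>q\<close>, \<open>dg q r\<close> are the degrees of its basis elements, and \<open>A q\<close> is the
  matrix of the map from \<open>G\<^sub>q\<^sub>+\<^sub>1\<close> to \<open>G\<^sub>q\<close>. Nothing is required of the
  cokernel of the last map.\<close>

locale graded_exact_complex =
  fixes rk :: "nat \<Rightarrow> nat" and dg :: "nat \<Rightarrow> nat \<Rightarrow> int"
    and A :: "nat \<Rightarrow> nat \<Rightarrow> nat \<Rightarrow> ('n::{finite,linorder}, 'k::field) mpoly"
  assumes homogeneous_entry: "\<And>q r c. r < rk q \<Longrightarrow> c < rk (Suc q) \<Longrightarrow>
      homogeneous (dg (Suc q) c - dg q r) (A q r c)"
    and exact: "\<And>q v. (\<forall>r<rk q. (\<Sum>c<rk (Suc q). A q r c * v c) = 0) \<longleftrightarrow>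
      (\<exists>w. \<forall>c<rk (Suc q). v c = (\<Sum>b<rk (Suc (Suc q)). A (Suc q) c b * w b))"
begin

text \<open>The map from \<open>G\<^sub>q\<^sub>+\<^sub>1\<close> to \<open>G\<^sub>q\<close>.\<close>

definition app :: "nat \<Rightarrow> (nat \<Rightarrow> ('n, 'k) mpoly) \<Rightarrow> nat \<Rightarrow> ('n, 'k) mpoly" where
  "app q v r = (\<Sum>c<rk (Suc q). A q r c * v c)"

lemma app_diff: "app q (\<lambda>c. v c - w c) r = app q v r - app q w r"
  by (simp add: app_def algebra_simps sum_subtractf)

lemma app_cong: "(\<And>c. c < rk (Suc q) \<Longrightarrow> v c = w c) \<Longrightarrow> app q v r = app q w r"
  by (simp add: app_def)

lemma app_app: "r < rk q \<Longrightarrow> app q (app (Suc q) w) r = 0"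
  using exact[of q "app (Suc q) w"] by (auto simp: app_def)

lemma app_kernel: "(\<And>r. r < rk q \<Longrightarrow> app q v r = 0) \<Longrightarrow> \<exists>w. \<forall>c<rk (Suc q). v c = app (Suc q) w c"
  using exact[of q v] by (simp add: app_def)

lemma koszul_bd_app: "koszul_bd (\<lambda>J. app q (w J) r) J = app q (\<lambda>c. koszul_bd (\<lambda>J. w J c) J) r"
  by (simp add: app_def koszul_bd_linear)

lemma homogeneous_preimage:
  assumes "\<And>r. r < rk q \<Longrightarrow> v r = app q w r"
    and "\<And>r. r < rk q \<Longrightarrow> homogeneous (d - dg q r) (v r)"
  shows "\<exists>w'. (\<forall>c<rk (Suc q). homogeneous (d - dg (Suc q) c) (w' c)) \<and>
    (\<forall>r<rk q. v r = app q w' r)"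
proof (intro exI conjI allI impI)
  let ?w' = "\<lambda>c. hpart (d - dg (Suc q) c) (w c)"
  show "homogeneous (d - dg (Suc q) c) (?w' c)" for c by (rule homogeneous_hpart)
  fix r assume r: "r < rk q"
  have "v r = hpart (d - dg q r) (app q w r)"
    using assms r by (metis hpart_homogeneous)
  also have "\<dots> = app q ?w' r"
    using r by (simp add: app_def hpart_sum hpart_mult[OF homogeneous_entry])
  finally show "v r = app q ?w' r" .
qed

text \<open>The diagram chase in the double complex of \<open>G\<close> and the Koszul complex \<open>K\<close>, along the
  diagonal \<open>p + q = M\<close>: if all basis elements of \<open>G\<^sub>M\<close> have degree less than \<open>D\<close>, then an
  element of \<open>G\<^sub>q \<otimes> K\<^sub>p\<close> of degree \<open>D\<close> whose Koszul boundary comes from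
  \<open>G\<^sub>q\<^sub>+\<^sub>1\<close> is the sum of a Koszul boundary and an element that comes from
  \<open>G\<^sub>q\<^sub>+\<^sub>1\<close>. The end of the chase is in \<open>G\<^sub>M \<otimes> K\<^sub>0\<close>, where
  the bound on the degrees excludes constant coefficients.\<close>

lemma koszul_chase:
  fixes z :: "'n set \<Rightarrow> nat \<Rightarrow> ('n, 'k) mpoly"
  assumes bound: "\<And>r. r < rk M \<Longrightarrow> dg M r < D"
    and "p + q = M"
    and "\<And>J r. card J = p \<Longrightarrow> r < rk q \<Longrightarrow> homogeneous (D - int p - dg q r) (z J r)"
    and "\<And>J. Suc (card J) = p \<Longrightarrow>
      \<exists>w. \<forall>r<rk q. koszul_bd (\<lambda>J. z J r) J = app q w r"
  shows "\<exists>y y'. \<forall>J. card J = p \<longrightarrow>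
    (\<forall>r<rk q. z J r = koszul_bd (\<lambda>J. y J r) J + app q (y' J) r)"
  using assms(2-)
proof (induction p arbitrary: q z)
  case 0
  have "z {} r = koszul_bd (koszul_cone (\<lambda>J. z J r)) {}" if "r < rk q" for r
  proof (rule koszul_exact)
    have "homogeneous (D - dg q r) (z {} r)" using "0.prems"(2)[of "{}"] that by simp
    moreover have "dg q r < D" using bound "0.prems"(1) that by simp
    ultimately show "lookup (z {} r) 0 = 0"
      by (auto simp: homogeneous_iff dest!: spec[of _ 0])
  qed simp
  then show ?case
    by (intro exI[of _ "\<lambda>J r. koszul_cone (\<lambda>J. z J r) J"] exI[of _ "\<lambda>_ _. 0"])
      (auto simp: app_def)
next
  case (Suc p)
  have "\<exists>w. (\<forall>c<rk (Suc q). homogeneous (D - int p - dg (Suc q) c) (w c)) \<and>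
    (\<forall>r<rk q. koszul_bd (\<lambda>J. z J r) J = app q w r)" if J: "card J = p" for J
  proof -
    obtain w where w: "\<And>r. r < rk q \<Longrightarrow> koszul_bd (\<lambda>J. z J r) J = app q w r"
      using Suc.prems(3)[of J] J by auto
    have "homogeneous (D - int p - dg q r) (koszul_bd (\<lambda>J. z J r) J)" if "r < rk q" for r
    proof -
      have "homogeneous (1 + (D - int (Suc p) - dg q r)) (koszul_bd (\<lambda>J. z J r) J)"
        by (rule homogeneous_koszul_bd) (use J that Suc.prems(2) in simp)
      then show ?thesis by (simp add: algebra_simps)
    qed
    then show ?thesis using w by (rule homogeneous_preimage[rotated])
  qed
  then obtain w where w_hom: "\<And>J c. card J = p \<Longrightarrow> c < rk (Suc q) \<Longrightarrow>
      homogeneous (D - int p - dg (Suc q) c) (w J c)"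
    and w: "\<And>J r. card J = p \<Longrightarrow> r < rk q \<Longrightarrow> koszul_bd (\<lambda>J. z J r) J = app q (w J) r"
    by metis
  have "\<exists>w'. \<forall>c<rk (Suc q). koszul_bd (\<lambda>J. w J c) J = app (Suc q) w' c"
    if J: "Suc (card J) = p" for J
  proof (rule app_kernel)
    fix r assume r: "r < rk q"
    have "app q (\<lambda>c. koszul_bd (\<lambda>J. w J c) J) r = koszul_bd (\<lambda>J. app q (w J) r) J"
      by (rule koszul_bd_app[symmetric])
    also have "\<dots> = koszul_bd (koszul_bd (\<lambda>J. z J r)) J"
      by (rule koszul_bd_cong) (use J w r in simp)
    finally show "app q (\<lambda>c. koszul_bd (\<lambda>J. w J c) J) r = 0"
      by (simp add: koszul_bd_bd)
  qed
  with Suc.IH[of "Suc q" w] Suc.prems(1) w_hom obtain y y' where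
    y: "\<And>J c. card J = p \<Longrightarrow> c < rk (Suc q) \<Longrightarrow>
      w J c = koszul_bd (\<lambda>J. y J c) J + app (Suc q) (y' J) c"
    by auto
  define u where "u J r = z J r - app q (y J) r" for J r
  have u_cycle: "koszul_bd (\<lambda>J. u J r) J = 0" if J: "card J = p" and r: "r < rk q" for J r
  proof -
    have "koszul_bd (\<lambda>J. u J r) J = app q (\<lambda>c. w J c - koszul_bd (\<lambda>J. y J c) J) r"
      using w[OF J r] by (simp add: u_def koszul_bd_diff koszul_bd_app app_diff)
    also have "\<dots> = app q (app (Suc q) (y' J)) r"
      by (rule app_cong) (use y J in simp)
    finally show ?thesis using r by (simp add: app_app)
  qed
  have "z J r = koszul_bd (koszul_cone (\<lambda>J. u J r)) J + app q (y J) r"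
    if "card J = Suc p" "r < rk q" for J r
  proof -
    have "u J r = koszul_bd (koszul_cone (\<lambda>J. u J r)) J"
      by (rule koszul_exact[of J "\<lambda>J. u J r"]) (use u_cycle that in auto)
    then show ?thesis by (simp add: u_def algebra_simps)
  qed
  then show ?case
    by (intro exI[of _ "\<lambda>J r. koszul_cone (\<lambda>J. u J r) J"] exI[of _ y]) auto
qed

text \<open>If \<open>G\<close> resolves \<open>S/I\<close>, a monomial \<open>x\<^sup>a \<notin> I\<close> in the variables \<open>V\<close> which is
  multiplied into \<open>I\<close> by each of them gives the cycle
  \<open>x\<^sup>a e\<^sub>V\<close> of the Koszul complex of \<open>S/I\<close>. It is not a
  boundary, since the coefficient of \<open>x\<^sup>a\<close> in a sum of multiples of variables outside of
  \<open>V\<close> vanishes. So the free module in homological degree \<open>card V\<close> has a basis element in the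
  degree of this cycle or above.\<close>

lemma socle_degree_le:
  assumes rk0: "rk 0 = 1" and dg0: "dg 0 0 = 0"
    and image: "\<And>f. f \<in> I \<longleftrightarrow> (\<exists>w. f = app 0 w 0)"
    and I: "monomial_ideal I"
    and a: "mon a \<notin> I" "keys a \<subseteq> V" "\<And>j. j \<in> V \<Longrightarrow> mon (expo j + a) \<in> I"
  shows "\<exists>r<rk (card V). int (mdeg a) + int (card V) \<le> dg (card V) r"
proof (rule ccontr)
  assume neg: "\<not> ?thesis"
  define z :: "'n set \<Rightarrow> nat \<Rightarrow> ('n, 'k) mpoly" where "z J r = (if J = V then mon a else 0)" for J r
  have "\<exists>y y'. \<forall>J. card J = card V \<longrightarrow> 
      (\<forall>r<rk 0. z J r = koszul_bd (\<lambda>J. y J r) J + app 0 (y' J) r)"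
  proof (rule koszul_chase[where M = "card V" and D = "int (mdeg a) + int (card V)"])
    show "dg (card V) r < int (mdeg a) + int (card V)" if "r < rk (card V)" for r
      using neg that by force
    show "homogeneous (int (mdeg a) + int (card V) - int (card V) - dg 0 r) (z J r)"
      if "r < rk 0" for J r
      using that rk0 dg0 by (simp add: z_def homogeneous_def)
    show "\<exists>w. \<forall>r<rk 0. koszul_bd (\<lambda>J. z J r) J = app 0 w r" for J
    proof -
      obtain B where B: "I = ideal_gen (mon ` B)" using I by (auto simp: monomial_ideal_def)
      have "koszul_sign j J * (var j * z (insert j J) 0) \<in> I" for j
      proof (cases "insert j J = V")
        case True
        then have "mon (expo j + a) \<in> I" using a(3) by blast
        then show ?thesis using True unfolding z_def var_eq_mon B
          by (auto simp: mon_mult intro: ideal_gen_scale)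
      qed (simp add: z_def B ideal_gen_zero)
      then have "koszul_bd (\<lambda>J. z J 0) J \<in> I"
        unfolding koszul_bd_def B by (intro ideal_gen_sum)
      then show ?thesis using image rk0 by auto
    qed
  qed simp
  then obtain y y' where y: "mon a = koszul_bd (\<lambda>J. y J 0) V + app 0 (y' V) 0"
    using rk0 by (auto simp: z_def)
  have "lookup (koszul_bd (\<lambda>J. y J 0) V) a = 0"
    using a(2) by (simp add: lookup_koszul_bd Diff_eq_empty_iff[THEN iffD2])
  then have "lookup (app 0 (y' V) 0) a = 1"
    using arg_cong[OF y, of "\<lambda>f. lookup f a"] by (simp add: lookup_add mon_def)
  moreover have "app 0 (y' V) 0 \<in> I" using image by blast
  ultimately have "mon a \<in> I"
    using monomial_ideal_mem_iff[OF I] by (metis in_keys_iff zero_neq_one)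
  then show False using a(1) by simp
qed

end

subsection \<open>Graded free resolutions of monomial ideals\<close>

lemma vec_mem_image_mat_iff:
  assumes "\<Phi> \<in> carrier_mat nr nc"
  shows "vec nr v \<in> (\<lambda>w. \<Phi> *\<^sub>v w) ` carrier_vec nc \<longleftrightarrow>
    (\<exists>w. \<forall>r<nr. v r = (\<Sum>c<nc. \<Phi> $$ (r, c) * w c))"
proof
  assume "vec nr v \<in> (\<lambda>w. \<Phi> *\<^sub>v w) ` carrier_vec nc"
  then obtain w where w: "w \<in> carrier_vec nc" "vec nr v = \<Phi> *\<^sub>v w" by auto
  then have "v r = (\<Phi> *\<^sub>v w) $ r" if "r < nr" for r
    using that by (metis index_vec)
  then have "\<forall>r<nr. v r = (\<Sum>c<nc. \<Phi> $$ (r, c) * w $ c)"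
    using assms w(1) by (auto simp: scalar_prod_def lessThan_atLeast0 intro!: sum.cong)
  then show "\<exists>w. \<forall>r<nr. v r = (\<Sum>c<nc. \<Phi> $$ (r, c) * w c)" by blast
next
  assume "\<exists>w. \<forall>r<nr. v r = (\<Sum>c<nc. \<Phi> $$ (r, c) * w c)"
  then obtain w where "\<And>r. r < nr \<Longrightarrow> v r = (\<Sum>c<nc. \<Phi> $$ (r, c) * w c)" by blast
  then have "vec nr v = \<Phi> *\<^sub>v vec nc w"
    using assms by (intro eq_vecI) (auto simp: scalar_prod_def lessThan_atLeast0 intro!: sum.cong)
  then show "vec nr v \<in> (\<lambda>w. \<Phi> *\<^sub>v w) ` carrier_vec nc" by auto
qed

lemma mult_mat_vec_eq_zero_iff:
  assumes "\<Phi> \<in> carrier_mat nr nc"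
  shows "\<Phi> *\<^sub>v vec nc v = 0\<^sub>v nr \<longleftrightarrow> (\<forall>r<nr. (\<Sum>c<nc. \<Phi> $$ (r, c) * v c) = 0)"
  using assms by (auto simp: vec_eq_iff scalar_prod_def lessThan_atLeast0 row_def)

lemma augmentation_vec:
  fixes g :: "'a::comm_ring_1 list"
  shows "augmentation (*) g (vec (length g) v) = (\<Sum>k<length g. g ! k * v k)"
  by (auto simp: augmentation_def mult.commute intro!: sum.cong)

lemma carrier_vec_eq_vec: "carrier_vec n = range (vec n)"
proof (intro equalityI subsetI)
  fix v :: "'a vec" assume "v \<in> carrier_vec n"
  then have "v = vec n (\<lambda>i. v $ i)" by (intro eq_vecI) auto
  then show "v \<in> range (vec n)" by blast
qed auto

text \<open>In an arbitrary, not necessarily minimal, resolution of \<open>I\<close>, a socle element with respect to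
  \<open>i + 1\<close> variables forces a basis element of \<open>F\<^sub>i\<close> of at least its degree plus \<open>i + 1\<close>.\<close>

lemma resolution_degree_ge_socle:
  fixes I :: "('n::{finite,linorder}, 'k::field) mpoly set"
  assumes res: "graded_free_resolution (*) I (\<lambda>d. {f \<in> I. homogeneous d f}) d g \<phi>"
    and I: "monomial_ideal I"
    and a: "mon a \<notin> I" "keys a \<subseteq> V" "\<And>j. j \<in> V \<Longrightarrow> mon (expo j + a) \<in> I"
    and V: "card V = Suc i"
  shows "\<exists>x\<in>set (d i). int (mdeg a) + int (Suc i) \<le> x"
proof -
  \<comment> \<open>The resolution of \<open>I\<close>, continued by the map to \<open>S\<close>, is a resolution of \<open>S/I\<close>; this shifts the
    homological degrees by one.\<close>
  define rk where "rk q = (case q of 0 \<Rightarrow> 1 | Suc i \<Rightarrow> length (d i))" for q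
  define dg where "dg q r = (case q of 0 \<Rightarrow> 0 | Suc i \<Rightarrow> d i ! r)" for q r
  define A where "A q r c = (case q of 0 \<Rightarrow> g ! c | Suc i \<Rightarrow> \<phi> i $$ (r, c))" for q r c
  note defs = rk_def dg_def A_def
  have len: "length g = length (d 0)"
    and gr: "\<And>k. k < length g \<Longrightarrow> homogeneous (d 0 ! k) (g ! k)"
    and carrier: "\<And>i. \<phi> i \<in> carrier_mat (length (d i)) (length (d (Suc i)))"
    and hom: "\<And>i r c. r < length (d i) \<Longrightarrow> c < length (d (Suc i)) \<Longrightarrow>
      homogeneous (d (Suc i) ! c - d i ! r) (\<phi> i $$ (r, c))"
    and aug: "augmentation (*) g ` carrier_vec (length (d 0)) = I"
    and ex0: "(\<lambda>w. \<phi> 0 *\<^sub>v w) ` carrier_vec (length (d 1)) =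
       {v \<in> carrier_vec (length (d 0)). augmentation (*) g v = 0}"
    and exS: "\<And>i. (\<lambda>w. \<phi> (Suc i) *\<^sub>v w) ` carrier_vec (length (d (Suc (Suc i)))) =
       {v \<in> carrier_vec (length (d (Suc i))). \<phi> i *\<^sub>v v = 0\<^sub>v (length (d i))}"
    using res unfolding graded_free_resolution_def by auto
  interpret graded_exact_complex rk dg A
  proof
    show "homogeneous (dg (Suc q) c - dg q r) (A q r c)" if "r < rk q" "c < rk (Suc q)" for q r c
      using that gr hom len by (cases q) (simp_all add: defs)
    show "(\<forall>r<rk q. (\<Sum>c<rk (Suc q). A q r c * v c) = 0) \<longleftrightarrow>
      (\<exists>w. \<forall>c<rk (Suc q). v c = (\<Sum>b<rk (Suc (Suc q)). A (Suc q) c b * w b))" for q v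
    proof (cases q)
      case 0
      have "vec (length (d 0)) v \<in> (\<lambda>w. \<phi> 0 *\<^sub>v w) ` carrier_vec (length (d 1)) \<longleftrightarrow>
        (\<Sum>k<length (d 0). g ! k * v k) = 0"
        unfolding ex0 using augmentation_vec[of g v] len by simp
      then show ?thesis
        using vec_mem_image_mat_iff[OF carrier[of 0], of v] 0 by (simp add: defs)
    next
      case (Suc i)
      have "vec (length (d (Suc i))) v \<in>
          (\<lambda>w. \<phi> (Suc i) *\<^sub>v w) ` carrier_vec (length (d (Suc (Suc i)))) \<longleftrightarrow>
        (\<forall>r<length (d i). (\<Sum>c<length (d (Suc i)). \<phi> i $$ (r, c) * v c) = 0)"
        unfolding exS using mult_mat_vec_eq_zero_iff[OF carrier[of i], of v] by simp
      then show ?thesis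
        using vec_mem_image_mat_iff[OF carrier[of "Suc i"], of v] Suc by (simp add: defs)
    qed
  qed
  have image: "f \<in> I \<longleftrightarrow> (\<exists>w. f = app 0 w 0)" for f
    unfolding aug[symmetric] carrier_vec_eq_vec image_image len[symmetric] augmentation_vec
    by (auto simp: app_def defs len)
  have "\<exists>r<rk (card V). int (mdeg a) + int (card V) \<le> dg (card V) r"
    by (rule socle_degree_le[OF _ _ image I a]) (simp_all add: defs)
  then show ?thesis using V by (auto simp: defs)
qed

section \<open>Existence of minimal resolutions of monomial ideals\<close>

subsection \<open>Dickson's lemma\<close>

lemma nat_seq_incseq_subseq:
  fixes s :: "nat \<Rightarrow> nat"
  shows "\<exists>r. strict_mono r \<and> incseq (\<lambda>n. s (r n))"
proof -
  obtain r where r: "strict_mono r" "monoseq (\<lambda>n. s (r n))" using seq_monosub by blast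
  show ?thesis
  proof (cases "incseq (\<lambda>n. s (r n))")
    case False
    with r(2) have dec: "decseq (\<lambda>n. s (r n))" by (simp add: monoseq_iff)
    obtain N where N: "\<And>n. s (r N) \<le> s (r n)"
      using ex_has_least_nat[of "\<lambda>_. True" 0 "\<lambda>n. s (r n)"] by auto
    have "s (r (N + n)) = s (r N)" for n
      using decseqD[OF dec, of N "N + n"] N[of "N + n"] by simp
    then have "strict_mono (\<lambda>n. r (N + n)) \<and> incseq (\<lambda>n. s (r (N + n)))"
      using r(1) by (auto simp: strict_mono_def incseq_def)
    then show ?thesis by (intro exI[of _ "\<lambda>n. r (N + n)"])
  qed (use r in blast)
qed

lemma monomial_seq_incseq_subseq:
  fixes f :: "nat \<Rightarrow> 'n monomial"
  assumes "finite V"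
  shows "\<exists>r. strict_mono r \<and> (\<forall>i\<in>V. incseq (\<lambda>n. lookup (f (r n)) i))"
  using assms
proof (induction V)
  case empty
  then show ?case by (intro exI[of _ id]) (simp add: strict_mono_def)
next
  case (insert i V)
  then obtain r where r: "strict_mono r" "\<And>i. i \<in> V \<Longrightarrow> incseq (\<lambda>n. lookup (f (r n)) i)"
    by blast
  obtain s where s: "strict_mono s" "incseq (\<lambda>n. lookup (f (r (s n))) i)"
    using nat_seq_incseq_subseq[of "\<lambda>n. lookup (f (r n)) i"] by blast
  have "incseq (\<lambda>n. lookup (f (r (s n))) j)" if "j \<in> V" for j
    using r(2)[OF that] s(1) by (simp add: incseq_def strict_mono_less_eq)
  then show ?case using r(1) s
    by (intro exI[of _ "\<lambda>n. r (s n)"]) (auto simp: strict_mono_def)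
qed

text \<open>The elements of \<open>A\<close> that are minimal for divisibility; there are only finitely many.\<close>

definition minimal_monomials :: "'n monomial set \<Rightarrow> 'n monomial set" where
  "minimal_monomials A = {a\<in>A. \<forall>b\<in>A. mdvd b a \<longrightarrow> b = a}"

lemma finite_minimal_monomials: "finite (minimal_monomials (A :: ('n::finite) monomial set))"
proof (rule ccontr)
  assume "infinite (minimal_monomials A)"
  then obtain f :: "nat \<Rightarrow> 'n monomial" where f: "inj f" "range f \<subseteq> minimal_monomials A"
    using infinite_countable_subset by blast
  obtain r where r: "strict_mono r" "\<And>i. incseq (\<lambda>n. lookup (f (r n)) i)"
    using monomial_seq_incseq_subseq[of UNIV f] by auto
  have "mdvd (f (r 0)) (f (r 1))" using r(2) by (simp add: mdvd_iff incseq_def)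
  then have "f (r 0) = f (r 1)" using f(2) by (simp add: minimal_monomials_def image_subset_iff)
  then have "r 0 = r 1" using f(1) by (simp add: inj_eq)
  then show False using r(1) by (simp add: strict_mono_eq)
qed

lemma minimal_monomials_below:
  assumes "a \<in> A"
  shows "\<exists>b\<in>minimal_monomials A. mdvd b (a :: ('n::finite) monomial)"
  using assms
proof (induction "mdeg a" arbitrary: a rule: less_induct)
  case less
  show ?case
  proof (cases "a \<in> minimal_monomials A")
    case False
    then obtain b where b: "b \<in> A" "mdvd b a" "b \<noteq> a"
      using less.prems by (auto simp: minimal_monomials_def)
    then obtain c where c: "a = b + c" "c \<noteq> 0" by (auto simp: mdvd_def)
    from c(2) obtain i where "0 < lookup c i" by (rule monomial_nonzeroE)
    then have "0 < mdeg c" using mdvd_mdeg_le[of "expo i" c] by (simp add: mdvd_expo_iff)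
    then have "mdeg b < mdeg a" using c by (simp add: mdeg_add)
    with less.hyps b show ?thesis by (blast intro: mdvd_trans)
  qed (use mdvd_refl in blast)
qed

lemma ideal_gen_minimal_monomials:
  "ideal_gen (mon ` minimal_monomials A) =
    (ideal_gen (mon ` A) :: ('n::finite, 'k::field) mpoly set)"
proof -
  have "(\<exists>b\<in>minimal_monomials A. mdvd b a) \<longleftrightarrow> (\<exists>b\<in>A. mdvd b a)" for a
  proof
    assume "\<exists>b\<in>A. mdvd b a"
    then show "\<exists>b\<in>minimal_monomials A. mdvd b a"
      using minimal_monomials_below by (meson mdvd_trans)
  qed (auto simp: minimal_monomials_def)
  then show ?thesis by (auto simp: mem_monomial_ideal_iff)
qed

subsection \<open>Multigraded relations\<close>

text \<open>A multihomogeneous basis element of a free module, together with its image in a multigraded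
  free module, is encoded as a pair \<open>(b, u)\<close> of a multidegree \<open>b\<close> and a vector \<open>u\<close>
  of scalars: if the basis of the target has the multidegrees \<open>a\<^sub>r\<close>, the image is
  \<open>\<Sum>\<^sub>r u\<^sub>r x\<^bsup>b - a\<^sub>r\<^esup> e\<^sub>r\<close>. So a map of multigraded free modules is given by a
  list of such pairs, and an element of multidegree \<open>b\<close> of its kernel by a vector of scalars
  which is a linear relation of the \<open>u\<close>, supported in the basis elements whose multidegree
  divides \<open>b\<close>.\<close>

type_synonym ('n, 'k) mgens = "('n monomial \<times> (nat \<Rightarrow> 'k)) list"

definition mrelation :: "('n, 'k::field) mgens \<Rightarrow> 'n monomial \<Rightarrow> (nat \<Rightarrow> 'k) \<Rightarrow> bool" where
  "mrelation ps b u \<longleftrightarrow> (\<forall>j. u j \<noteq> 0 \<longrightarrow> j < length ps \<and> mdvd (fst (ps ! j)) b) \<and>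
     (\<forall>r. (\<Sum>j<length ps. u j * snd (ps ! j) r) = 0)"

text \<open>\<open>G\<close> is a set of multihomogeneous generators of the kernel.\<close>

definition mgenerates :: "('n, 'k::field) mgens \<Rightarrow> ('n monomial \<times> (nat \<Rightarrow> 'k)) set \<Rightarrow> bool" where
  "mgenerates ps G \<longleftrightarrow> (\<forall>p\<in>G. mrelation ps (fst p) (snd p)) \<and>
     (\<forall>b u. mrelation ps b u \<longrightarrow>
        (\<exists>c. (\<forall>p\<in>G. c p \<noteq> 0 \<longrightarrow> mdvd (fst p) b) \<and> (\<forall>j. u j = (\<Sum>p\<in>G. c p * snd p j))))"

text \<open>Subspaces of \<open>K\<^sup>n\<close> are finitely generated. The closure condition covers sums and multiples, as a
  nonempty set \<open>U\<close> contains \<open>u - 1 u\<close>; for the empty set the claim is trivial.\<close>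

lemma finite_spanning_set:
  fixes U :: "(nat \<Rightarrow> 'k::field) set"
  assumes "\<And>u j. u \<in> U \<Longrightarrow> n \<le> j \<Longrightarrow> u j = 0"
    and "\<And>u v c. u \<in> U \<Longrightarrow> v \<in> U \<Longrightarrow> (\<lambda>j. u j - c * v j) \<in> U"
  shows "\<exists>B\<subseteq>U. finite B \<and> (\<forall>u\<in>U. \<exists>c. \<forall>j. u j = (\<Sum>v\<in>B. c v * v j))"
  using assms
proof (induction n arbitrary: U)
  case 0
  then show ?case by (intro exI[of _ "{}"]) auto
next
  case (Suc n)
  have vanish: "u j = 0" if "u \<in> U" "u n = 0" "n \<le> j" for u j
    using Suc.prems(1)[OF that(1), of j] that by (cases "j = n") auto
  show ?case
  proof (cases "\<exists>v\<in>U. v n \<noteq> 0")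
    case False
    then show ?thesis using Suc.prems(2) vanish by (intro Suc.IH) auto
  next
    case True
    then obtain v0 where v0: "v0 \<in> U" "v0 n \<noteq> 0" by blast
    have "\<exists>B\<subseteq>{u\<in>U. u n = 0}. finite B \<and>
      (\<forall>u\<in>{u\<in>U. u n = 0}. \<exists>c. \<forall>j. u j = (\<Sum>v\<in>B. c v * v j))"
      using Suc.prems(2) vanish by (intro Suc.IH) auto
    then obtain B where B: "B \<subseteq> {u\<in>U. u n = 0}" "finite B"
      and span: "\<And>u. u \<in> U \<Longrightarrow> u n = 0 \<Longrightarrow> \<exists>c. \<forall>j. u j = (\<Sum>v\<in>B. c v * v j)"
      by auto
    have "v0 \<notin> B" using B v0 by auto
    show ?thesis
    proof (intro exI[of _ "insert v0 B"] conjI ballI)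
      fix u assume u: "u \<in> U"
      define q where "q = u n / v0 n"
      have "\<exists>c. \<forall>j. u j - q * v0 j = (\<Sum>v\<in>B. c v * v j)"
        using v0(2) by (intro span Suc.prems(2) u v0(1)) (simp add: q_def)
      then obtain c where c: "\<And>j. u j - q * v0 j = (\<Sum>v\<in>B. c v * v j)" by blast
      have "u j = (\<Sum>v\<in>insert v0 B. (c(v0 := q)) v * v j)" for j
      proof -
        have "(\<Sum>v\<in>B. (c(v0 := q)) v * v j) = (\<Sum>v\<in>B. c v * v j)"
          using \<open>v0 \<notin> B\<close> by (intro sum.cong) auto
        then show ?thesis using c[of j] B(2) \<open>v0 \<notin> B\<close> by (simp add: algebra_simps)
      qed
      then show "\<exists>c. \<forall>j. u j = (\<Sum>v\<in>insert v0 B. c v * v j)" by blast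
    qed (use B v0 in auto)
  qed
qed

lemma monomial_lcm_exists:
  assumes "finite T"
  shows "\<exists>m. \<forall>b. mdvd m b \<longleftrightarrow> (\<forall>j\<in>T. mdvd (a j :: 'n monomial) b)"
  using assms
proof (induction T)
  case empty
  then show ?case by (intro exI[of _ 0]) simp
next
  case (insert j T)
  then obtain m where m: "\<And>b. mdvd m b \<longleftrightarrow> (\<forall>j\<in>T. mdvd (a j) b)" by blast
  have "mdvd (m + (a j - m)) b \<longleftrightarrow> mdvd m b \<and> mdvd (a j) b" for b
  proof -
    have "x + (y - x) \<le> z \<longleftrightarrow> x \<le> z \<and> y \<le> z" for x y z :: nat by arith
    then show ?thesis by (simp add: mdvd_iff lookup_add lookup_minus all_conj_distrib)
  qed
  then show ?case using m by (intro exI[of _ "m + (a j - m)"]) auto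
qed

text \<open>The relations of multidegree \<open>b\<close> depend only on the set of those basis elements whose
  multidegree divides \<open>b\<close>, so the least common multiples of sets of multidegrees suffice as
  degrees of generators.\<close>

lemma finite_mgenerates_exists: "\<exists>G. finite G \<and> mgenerates ps G"
proof -
  define deg where "deg j = fst (ps ! j)" for j
  define m where "m T = (SOME m. \<forall>b. mdvd m b \<longleftrightarrow> (\<forall>j\<in>T. mdvd (deg j) b))" for T
  have m: "mdvd (m T) b \<longleftrightarrow> (\<forall>j\<in>T. mdvd (deg j) b)" if "T \<subseteq> {..<length ps}" for T b
    using someI_ex[OF monomial_lcm_exists[OF finite_subset[OF that finite_lessThan], of deg]]
    unfolding m_def by blast
  define spans where "spans b B \<longleftrightarrow> B \<subseteq> {u. mrelation ps b u} \<and> finite B \<and>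
    (\<forall>u\<in>{u. mrelation ps b u}. \<exists>c. \<forall>j. u j = (\<Sum>v\<in>B. c v * v j))" for b B
  have "\<exists>B. spans b B" for b
    unfolding spans_def
  proof (rule finite_spanning_set[of _ "length ps"])
    fix u v c assume "u \<in> {u. mrelation ps b u}" "v \<in> {u. mrelation ps b u}"
    then have u: "mrelation ps b u" and v: "mrelation ps b v" by auto
    have "j < length ps \<and> mdvd (fst (ps ! j)) b" if "u j - c * v j \<noteq> 0" for j
    proof -
      from that have "u j \<noteq> 0 \<or> v j \<noteq> 0" by auto
      then show ?thesis using u v by (auto simp: mrelation_def)
    qed
    moreover have "(\<Sum>j<length ps. (u j - c * v j) * snd (ps ! j) r) = 0" for r
      using u v by (simp add: mrelation_def left_diff_distrib sum_subtractf mult.assoc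
          flip: sum_distrib_left)
    ultimately show "(\<lambda>j. u j - c * v j) \<in> {u. mrelation ps b u}"
      by (simp add: mrelation_def)
  qed (auto simp: mrelation_def)
  then obtain B where spans: "\<And>b. spans b (B b)" by metis
  have B: "finite (B b)" "\<And>u. u \<in> B b \<Longrightarrow> mrelation ps b u" for b
    using spans[of b] unfolding spans_def by auto
  have span: "\<exists>c. \<forall>j. u j = (\<Sum>v\<in>B b. c v * v j)" if "mrelation ps b u" for b u
    using spans[of b] that unfolding spans_def by simp
  \<comment> \<open>For each set \<open>T\<close> of basis elements, a finite spanning set of the relations of degree \<open>m T\<close>.\<close>
  define G where "G = (\<Union>T\<in>Pow {..<length ps}. {m T} \<times> B (m T))"
  have "finite G" unfolding G_def using B(1) by simp
  moreover have "mgenerates ps G"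
    unfolding mgenerates_def
  proof (intro conjI allI impI)
    fix b u assume u: "mrelation ps b u"
    define T where "T = {j. j < length ps \<and> mdvd (deg j) b}"
    have T: "T \<subseteq> {..<length ps}" by (auto simp: T_def)
    have mT: "mdvd (m T) b" using m[OF T] by (auto simp: T_def)
    have "mdvd (deg j) (m T)" if "j \<in> T" for j
      using m[OF T, of "m T"] that by simp
    then have "mrelation ps (m T) u"
      using u by (auto simp: mrelation_def T_def deg_def)
    then obtain c where c: "\<And>j. u j = (\<Sum>v\<in>B (m T). c v * v j)"
      using span by blast
    define c' where "c' p = (if p \<in> {m T} \<times> B (m T) then c (snd p) else 0)" for p
    have "u j = (\<Sum>p\<in>G. c' p * snd p j)" for j
    proof -
      have "u j = (\<Sum>p\<in>{m T} \<times> B (m T). c' p * snd p j)"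
        by (simp add: c c'_def sum.cartesian_product')
      also have "\<dots> = (\<Sum>p\<in>G. c' p * snd p j)"
        by (rule sum.mono_neutral_left) (use \<open>finite G\<close> T in \<open>auto simp: G_def c'_def\<close>)
      finally show ?thesis .
    qed
    moreover have "mdvd (fst p) b" if "c' p \<noteq> 0" for p
      using that mT by (auto simp: c'_def split: if_splits)
    ultimately show "\<exists>c. (\<forall>p\<in>G. c p \<noteq> 0 \<longrightarrow> mdvd (fst p) b) \<and>
        (\<forall>j. u j = (\<Sum>p\<in>G. c p * snd p j))"
      by blast
  qed (use B(2) in \<open>auto simp: G_def\<close>)
  ultimately show ?thesis by blast
qed

text \<open>A generator \<open>p0\<close> that occurs with a nonzero coefficient in a relation of its own degree is
  redundant.\<close>

lemma mgenerates_remove: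
  assumes G: "finite G" "mgenerates ps G" and p0: "p0 \<in> G" "c p0 \<noteq> 0"
    and c: "\<And>p. p \<in> G \<Longrightarrow> c p \<noteq> 0 \<Longrightarrow> mdvd (fst p) (fst p0)"
    and rel: "\<And>j. (\<Sum>p\<in>G. c p * snd p j) = 0"
  shows "mgenerates ps (G - {p0})"
  unfolding mgenerates_def
proof (intro conjI allI impI)
  fix b u assume "mrelation ps b u"
  then obtain e where e: "\<And>p. p \<in> G \<Longrightarrow> e p \<noteq> 0 \<Longrightarrow> mdvd (fst p) b"
    and u: "\<And>j. u j = (\<Sum>p\<in>G. e p * snd p j)"
    using G(2) unfolding mgenerates_def by metis
  define e' where "e' p = e p - e p0 / c p0 * c p" for p
  have "u j = (\<Sum>p\<in>G - {p0}. e' p * snd p j)" for j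
  proof -
    have "(\<Sum>p\<in>G. e' p * snd p j) = u j - e p0 / c p0 * (\<Sum>p\<in>G. c p * snd p j)"
      by (simp add: e'_def u left_diff_distrib sum_subtractf sum_distrib_left mult.assoc)
    moreover have "e' p0 = 0" using p0 by (simp add: e'_def)
    ultimately show ?thesis using rel[of j] G(1) p0(1) by (simp add: sum.remove)
  qed
  moreover have "mdvd (fst p) b" if "p \<in> G" "e' p \<noteq> 0" for p
  proof (cases "e p = 0")
    case True
    then have "e p0 \<noteq> 0" "c p \<noteq> 0" using that by (auto simp: e'_def)
    then show ?thesis using c that e[OF p0(1)] by (blast intro: mdvd_trans)
  qed (use e that in blast)
  ultimately show "\<exists>c. (\<forall>p\<in>G - {p0}. c p \<noteq> 0 \<longrightarrow> mdvd (fst p) b) \<and>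
      (\<forall>j. u j = (\<Sum>p\<in>G - {p0}. c p * snd p j))"
    by blast
qed (use G in \<open>auto simp: mgenerates_def\<close>)

text \<open>No relation has an entry of degree zero: the images of the basis elements are a minimal
  system of generators of the image of the map.\<close>

definition minimal_gens :: "('n, 'k::field) mgens \<Rightarrow> bool" where
  "minimal_gens ps \<longleftrightarrow> (\<forall>b u j. mrelation ps b u \<longrightarrow> u j \<noteq> 0 \<longrightarrow> fst (ps ! j) \<noteq> b)"

text \<open>\<open>ps'\<close> is the next map of a minimal resolution: its image is the kernel of \<open>ps\<close>, and it maps
  the basis to a minimal system of generators of this kernel.\<close>

definition next_gens :: "('n, 'k::field) mgens \<Rightarrow> ('n, 'k) mgens \<Rightarrow> bool" where
  "next_gens ps ps' \<longleftrightarrow> minimal_gens ps' \<and>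
     (\<forall>j<length ps'. mrelation ps (fst (ps' ! j)) (snd (ps' ! j))) \<and>
     (\<forall>b u. mrelation ps b u \<longrightarrow>
        (\<exists>c. (\<forall>j. c j \<noteq> 0 \<longrightarrow> j < length ps' \<and> mdvd (fst (ps' ! j)) b) \<and>
          (\<forall>r. u r = (\<Sum>j<length ps'. c j * snd (ps' ! j) r))))"

text \<open>A generating set of least cardinality is minimal, as a relation with an entry of degree zero
  would make a generator redundant.\<close>

lemma next_gens_exists: "\<exists>ps'. next_gens ps (ps' :: ('n, 'k::field) mgens)"
proof -
  obtain G0 where "finite G0 \<and> mgenerates ps G0" using finite_mgenerates_exists by blast
  from ex_has_least_nat[of "\<lambda>G. finite G \<and> mgenerates ps G", OF this, of card]
  obtain G where G: "finite G" "mgenerates ps G"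
    and least: "\<And>G'. finite G' \<Longrightarrow> mgenerates ps G' \<Longrightarrow> card G \<le> card G'"
    by auto
  obtain ps' where ps': "distinct ps'" "set ps' = G"
    using finite_distinct_list[OF G(1)] by blast
  have G_nth: "ps' ! j \<in> G" if "j < length ps'" for j using ps'(2) that by auto
  have bij: "bij_betw ((!) ps') {..<length ps'} G"
    using ps' by (intro bij_betw_nth) auto
  have sum_G: "(\<Sum>p\<in>G. f p) = (\<Sum>j<length ps'. f (ps' ! j))" for f :: "_ \<Rightarrow> 'k"
    by (rule sum.reindex_bij_betw[OF bij, symmetric])
  have "minimal_gens ps'"
    unfolding minimal_gens_def
  proof (intro allI impI notI)
    fix b u j assume u: "mrelation ps' b u" "u j \<noteq> 0" "fst (ps' ! j) = b"
    then have j: "j < length ps'" by (auto simp: mrelation_def)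
    define c where "c p = u (the_inv_into {..<length ps'} ((!) ps') p)" for p
    have c: "c (ps' ! i) = u i" if "i < length ps'" for i
      using that bij by (simp add: c_def the_inv_into_f_f bij_betw_def)
    have "mgenerates ps (G - {ps' ! j})"
    proof (rule mgenerates_remove[OF G])
      show "ps' ! j \<in> G" "c (ps' ! j) \<noteq> 0" using j ps' u c by auto
      show "mdvd (fst p) (fst (ps' ! j))" if p: "p \<in> G" "c p \<noteq> 0" for p
      proof -
        obtain i where "i < length ps'" "p = ps' ! i"
          using p(1) ps'(2) by (metis in_set_conv_nth)
        then show ?thesis using c p(2) u by (auto simp: mrelation_def)
      qed
      show "(\<Sum>p\<in>G. c p * snd p r) = 0" for r
        using u(1) by (simp add: sum_G c mrelation_def)
    qed
    then have "card G \<le> card (G - {ps' ! j})" using G(1) least by blast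
    moreover have "ps' ! j \<in> G" using j ps' by auto
    ultimately show False using G(1) by (metis card_Diff1_less not_less)
  qed
  moreover have "\<exists>c. (\<forall>j. c j \<noteq> 0 \<longrightarrow> j < length ps' \<and> mdvd (fst (ps' ! j)) b) \<and>
          (\<forall>r. u r = (\<Sum>j<length ps'. c j * snd (ps' ! j) r))" if u: "mrelation ps b u" for b u
  proof -
    obtain c where c: "\<And>p. p \<in> G \<Longrightarrow> c p \<noteq> 0 \<Longrightarrow> mdvd (fst p) b"
      and eq: "\<And>r. u r = (\<Sum>p\<in>G. c p * snd p r)"
      using G(2) u unfolding mgenerates_def by metis
    show ?thesis
    proof (intro exI[of _ "\<lambda>j. if j < length ps' then c (ps' ! j) else 0"] conjI allI impI)
      show "u r = (\<Sum>j<length ps'. (if j < length ps' then c (ps' ! j) else 0) * snd (ps' ! j) r)" for r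
        unfolding eq sum_G by (intro sum.cong) simp_all
    qed (use c G_nth in \<open>auto split: if_splits\<close>)
  qed
  ultimately have "next_gens ps ps'"
    unfolding next_gens_def using G(2) G_nth unfolding mgenerates_def by simp
  then show ?thesis by blast
qed

subsection \<open>The polynomial matrices\<close>

text \<open>The entry of the matrix of the multigraded map \<open>ps\<close> to the free module with the basis of
  \<open>qs\<close>. The subtraction of exponents is truncated, but wherever the coefficient does not vanish the
  multidegree of the basis element \<open>r\<close> divides that of \<open>c\<close>.\<close>

definition mentry :: "('n, 'k::field) mgens \<Rightarrow> ('n, 'k) mgens \<Rightarrow> nat \<Rightarrow> nat \<Rightarrow> ('n, 'k) mpoly" where
  "mentry qs ps r c = single (fst (ps ! c) - fst (qs ! r)) (snd (ps ! c) r)"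

text \<open>\<open>ps\<close> describes a multigraded map to the free module with the basis of \<open>qs\<close>; of \<open>qs\<close>, only
  the multidegrees matter.\<close>

definition mcompatible :: "('n, 'k::field) mgens \<Rightarrow> ('n, 'k) mgens \<Rightarrow> bool" where
  "mcompatible qs ps \<longleftrightarrow> (\<forall>c<length ps. \<forall>r. snd (ps ! c) r \<noteq> 0 \<longrightarrow>
     r < length qs \<and> mdvd (fst (qs ! r)) (fst (ps ! c)))"

lemma next_gens_mcompatible: "next_gens qs ps \<Longrightarrow> mcompatible qs ps"
  by (auto simp: next_gens_def mcompatible_def mrelation_def)

lemma monomial_diff_add_diff:
  "mdvd a b \<Longrightarrow> mdvd b c \<Longrightarrow> (b - a) + (c - b) = c - (a :: 'n monomial)"
  by (intro poly_mapping_eqI) (auto simp: mdvd_iff lookup_add lookup_minus)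

lemma mentry_composition:
  assumes comp: "mcompatible qs ps" and nxt: "next_gens ps ps'" and j: "j < length ps'"
  shows "(\<Sum>c<length ps. mentry qs ps r c * mentry ps ps' c j) = 0"
proof -
  let ?b = "fst (ps' ! j)" and ?u = "snd (ps' ! j)"
  have rel: "mrelation ps ?b ?u" using nxt j by (simp add: next_gens_def)
  have "mentry qs ps r c * mentry ps ps' c j =
      single (?b - fst (qs ! r)) (?u c * snd (ps ! c) r)" if c: "c < length ps" for c
  proof (cases "snd (ps ! c) r = 0 \<or> ?u c = 0")
    case False
    then have "mdvd (fst (qs ! r)) (fst (ps ! c))" "mdvd (fst (ps ! c)) ?b"
      using comp rel c by (auto simp: mcompatible_def mrelation_def)
    then show ?thesis
      by (simp add: mentry_def mult_single monomial_diff_add_diff mult.commute)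
  qed (auto simp: mentry_def)
  then have "(\<Sum>c<length ps. mentry qs ps r c * mentry ps ps' c j) =
      (\<Sum>c<length ps. single (?b - fst (qs ! r)) (?u c * snd (ps ! c) r))"
    by (intro sum.cong) auto
  also have "\<dots> = single (?b - fst (qs ! r)) (\<Sum>c<length ps. ?u c * snd (ps ! c) r)"
    by (rule poly_mapping_eqI) (simp add: lookup_sum lookup_single when_def)
  finally show ?thesis using rel by (simp add: mrelation_def)
qed

text \<open>The component of multidegree \<open>b\<close> of an element of the free module, as a vector of scalars.\<close>

definition mcomponent ::
  "('n, 'k::field) mgens \<Rightarrow> (nat \<Rightarrow> ('n, 'k) mpoly) \<Rightarrow> 'n monomial \<Rightarrow> nat \<Rightarrow> 'k" where
  "mcomponent ps v b c = (if c < length ps \<and> mdvd (fst (ps ! c)) b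
     then lookup (v c) (b - fst (ps ! c)) else 0)"

lemma mrelation_mcomponent:
  assumes comp: "mcompatible qs ps"
    and ker: "\<And>r. r < length qs \<Longrightarrow> (\<Sum>c<length ps. mentry qs ps r c * v c) = 0"
  shows "mrelation ps b (mcomponent ps v b)"
proof -
  have "(\<Sum>c<length ps. mcomponent ps v b c * snd (ps ! c) r) = 0" for r
  proof (cases "r < length qs \<and> mdvd (fst (qs ! r)) b")
    case False
    have "mcomponent ps v b c * snd (ps ! c) r = 0" if "c < length ps" for c
    proof (rule ccontr)
      assume "\<not> ?thesis"
      then have "mcomponent ps v b c \<noteq> 0" "snd (ps ! c) r \<noteq> 0" by auto
      then have "mdvd (fst (ps ! c)) b" "r < length qs" "mdvd (fst (qs ! r)) (fst (ps ! c))"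
        using comp that by (auto simp: mcompatible_def mcomponent_def split: if_splits)
      with False show False by (blast intro: mdvd_trans)
    qed
    then show ?thesis by (intro sum.neutral) auto
  next
    case True
    let ?a = "fst (qs ! r)"
    have "lookup (mentry qs ps r c * v c) (b - ?a) = mcomponent ps v b c * snd (ps ! c) r"
      if c: "c < length ps" for c
    proof (cases "snd (ps ! c) r = 0")
      case False
      let ?d = "fst (ps ! c)"
      have ad: "mdvd ?a ?d" using comp c False by (auto simp: mcompatible_def)
      have "mdvd (?d - ?a) (b - ?a) \<longleftrightarrow> mdvd ?d b"
      proof -
        have "y - x \<le> z - x \<longleftrightarrow> y \<le> z" if "x \<le> y" "x \<le> z" for x y z :: nat
          using that by arith
        then show ?thesis using ad True by (simp add: mdvd_iff lookup_minus)
      qed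
      moreover have "(b - ?a) - (?d - ?a) = b - ?d"
        using ad by (intro poly_mapping_eqI) (auto simp: mdvd_iff lookup_minus)
      ultimately show ?thesis using c
        by (simp add: mentry_def lookup_single_mult mcomponent_def)
    qed (simp add: mentry_def)
    then have "(\<Sum>c<length ps. mcomponent ps v b c * snd (ps ! c) r) =
        lookup (\<Sum>c<length ps. mentry qs ps r c * v c) (b - ?a)"
      unfolding lookup_sum by (intro sum.cong) auto
    then show ?thesis using ker True by simp
  qed
  then show ?thesis by (simp add: mrelation_def mcomponent_def)
qed

lemma sum_mcomponent:
  assumes c: "c < length ps"
    and B: "finite B" "\<And>a. a \<in> keys (v c) \<Longrightarrow> a + fst (ps ! c) \<in> B"
  shows "(\<Sum>b\<in>B. single (b - fst (ps ! c)) (mcomponent ps v b c)) = v c"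
proof (rule poly_mapping_eqI)
  fix m
  let ?a = "fst (ps ! c)"
  have "lookup (single (b - ?a) (mcomponent ps v b c)) m =
      (if b = m + ?a then lookup (v c) m else 0)" for b
  proof (cases "mdvd ?a b")
    case True
    then obtain d where "b = ?a + d" by (auto simp: mdvd_def)
    then have "b - ?a = m \<longleftrightarrow> b = m + ?a" by (simp add: add.commute[of m])
    then show ?thesis using True c by (auto simp: lookup_single mcomponent_def when_def)
  qed (auto simp: mcomponent_def)
  then have "lookup (\<Sum>b\<in>B. single (b - ?a) (mcomponent ps v b c)) m =
      (\<Sum>b\<in>B. if b = m + ?a then lookup (v c) m else 0)"
    by (simp add: lookup_sum)
  also have "\<dots> = (if m + ?a \<in> B then lookup (v c) m else 0)"
    using B(1) by simp
  also have "\<dots> = lookup (v c) m" using B(2)[of m] by (auto simp: in_keys_iff)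
  finally show "lookup (\<Sum>b\<in>B. single (b - ?a) (mcomponent ps v b c)) m = lookup (v c) m" .
qed

text \<open>Exactness of the polynomial matrices is exactness of the scalar ones in each multidegree. For an
  element \<open>v\<close> of the kernel, the scalar preimages of the finitely many nonzero components are
  assembled to a preimage of \<open>v\<close>.\<close>

lemma mentry_exact:
  assumes comp: "mcompatible qs ps" and nxt: "next_gens ps ps'"
  shows "(\<forall>r<length qs. (\<Sum>c<length ps. mentry qs ps r c * v c) = 0) \<longleftrightarrow>
    (\<exists>w. \<forall>c<length ps. v c = (\<Sum>j<length ps'. mentry ps ps' c j * w j))"
proof (intro iffI allI impI)
  assume "\<exists>w. \<forall>c<length ps. v c = (\<Sum>j<length ps'. mentry ps ps' c j * w j)"
  then obtain w where w: "\<And>c. c < length ps \<Longrightarrow> v c = (\<Sum>j<length ps'. mentry ps ps' c j * w j)"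
    by blast
  fix r
  have "(\<Sum>c<length ps. mentry qs ps r c * v c) =
      (\<Sum>c<length ps. \<Sum>j<length ps'. mentry qs ps r c * mentry ps ps' c j * w j)"
    by (intro sum.cong) (simp_all add: w sum_distrib_left mult.assoc)
  also have "\<dots> = (\<Sum>j<length ps'. (\<Sum>c<length ps. mentry qs ps r c * mentry ps ps' c j) * w j)"
    by (subst sum.swap) (simp add: sum_distrib_right)
  also have "\<dots> = 0" using mentry_composition[OF comp nxt] by simp
  finally show "(\<Sum>c<length ps. mentry qs ps r c * v c) = 0" .
next
  assume "\<forall>r<length qs. (\<Sum>c<length ps. mentry qs ps r c * v c) = 0"
  then have rel: "mrelation ps b (mcomponent ps v b)" for b
    using mrelation_mcomponent[OF comp] by blast
  define expands where "expands b l \<longleftrightarrow>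
      (\<forall>j. l j \<noteq> 0 \<longrightarrow> j < length ps' \<and> mdvd (fst (ps' ! j)) b) \<and>
      (\<forall>c. mcomponent ps v b c = (\<Sum>j<length ps'. l j * snd (ps' ! j) c))" for b l
  have "\<exists>l. expands b l" for b
    using nxt rel[of b] unfolding next_gens_def expands_def by simp
  then obtain l where expands: "\<And>b. expands b (l b)" by metis
  have l: "j < length ps' \<and> mdvd (fst (ps' ! j)) b" if "l b j \<noteq> 0" for b j
    using expands[of b] that unfolding expands_def by simp
  have eq: "mcomponent ps v b c = (\<Sum>j<length ps'. l b j * snd (ps' ! j) c)" for b c
    using expands[of b] unfolding expands_def by simp
  define B where "B = (\<Union>c<length ps. (\<lambda>a. a + fst (ps ! c)) ` keys (v c))"
  define w where "w j = (\<Sum>b\<in>B. single (b - fst (ps' ! j)) (l b j))" for j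
  have "v c = (\<Sum>j<length ps'. mentry ps ps' c j * w j)" if c: "c < length ps" for c
  proof -
    let ?a = "fst (ps ! c)"
    have prod: "mentry ps ps' c j * single (b - fst (ps' ! j)) (l b j) =
        single (b - ?a) (l b j * snd (ps' ! j) c)" if "j < length ps'" for b j
    proof (cases "l b j = 0 \<or> snd (ps' ! j) c = 0")
      case False
      then have "mdvd (fst (ps' ! j)) b" "mdvd ?a (fst (ps' ! j))"
        using l[of b j] that next_gens_mcompatible[OF nxt] by (auto simp: mcompatible_def)
      then show ?thesis
        by (simp add: mentry_def mult_single monomial_diff_add_diff mult.commute
            add.commute[of "b - _"])
    qed (auto simp: mentry_def)
    have "(\<Sum>j<length ps'. mentry ps ps' c j * w j) =
        (\<Sum>j<length ps'. \<Sum>b\<in>B. single (b - ?a) (l b j * snd (ps' ! j) c))"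
      by (intro sum.cong refl) (simp add: w_def sum_distrib_left prod)
    also have "\<dots> = (\<Sum>b\<in>B. single (b - ?a) (mcomponent ps v b c))"
      unfolding eq by (subst sum.swap, intro sum.cong refl poly_mapping_eqI)
        (simp add: lookup_sum lookup_single when_def)
    also have "\<dots> = v c"
      by (rule sum_mcomponent) (use c in \<open>auto simp: B_def\<close>)
    finally show ?thesis by simp
  qed
  then show "\<exists>w. \<forall>c<length ps. v c = (\<Sum>j<length ps'. mentry ps ps' c j * w j)" by blast
qed

subsection \<open>The resolution\<close>

lemma carrier_vec_Collect_eqI:
  assumes "X \<subseteq> carrier_vec n" "\<And>v. vec n v \<in> X \<longleftrightarrow> P (vec n v)"
  shows "X = {v \<in> carrier_vec n. P v}"
proof -
  have "v \<in> X \<longleftrightarrow> P v" if "v \<in> carrier_vec n" for v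
    using that assms(2) unfolding carrier_vec_eq_vec by auto
  then show ?thesis using assms(1) by blast
qed

text \<open>The maps of a minimal multigraded resolution, from the augmentation \<open>ps\<close> on.\<close>

primrec resolution_gens :: "('n, 'k::field) mgens \<Rightarrow> nat \<Rightarrow> ('n, 'k) mgens" where
  "resolution_gens ps 0 = ps"
| "resolution_gens ps (Suc i) = (SOME ps'. next_gens (resolution_gens ps i) ps')"

lemma next_gens_resolution_gens:
  "next_gens (resolution_gens ps i) (resolution_gens ps (Suc i))"
  using someI_ex[OF next_gens_exists] by simp

lemma homogeneous_mentry:
  fixes ps qs :: "('n::finite, 'k::field) mgens"
  assumes "mcompatible qs ps" "c < length ps"
  shows "homogeneous (int (mdeg (fst (ps ! c))) - int (mdeg (fst (qs ! r)))) (mentry qs ps r c)"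
proof (cases "snd (ps ! c) r = 0")
  case False
  then have "mdvd (fst (qs ! r)) (fst (ps ! c))" using assms by (auto simp: mcompatible_def)
  then have "mdeg (fst (ps ! c)) = mdeg (fst (qs ! r)) + mdeg (fst (ps ! c) - fst (qs ! r))"
    by (metis mdvd_minus_add mdeg_add)
  then show ?thesis by (simp add: mentry_def homogeneous_def)
qed (simp add: mentry_def)

lemma mentry_mem_irrelevant:
  fixes ps qs :: "('n::finite, 'k::field) mgens"
  assumes "minimal_gens qs" "next_gens qs ps" "c < length ps"
  shows "mentry qs ps r c \<in> ideal_gen (range var)"
proof (cases "snd (ps ! c) r = 0")
  case False
  have "mrelation qs (fst (ps ! c)) (snd (ps ! c))" using assms by (simp add: next_gens_def)
  with False assms(1) have "mdvd (fst (qs ! r)) (fst (ps ! c))" "fst (qs ! r) \<noteq> fst (ps ! c)"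
    by (auto simp: minimal_gens_def mrelation_def)
  then have "fst (ps ! c) - fst (qs ! r) \<noteq> 0" by (metis mdvd_minus_add add_0_right)
  then obtain i where "mdvd (expo i) (fst (ps ! c) - fst (qs ! r))"
    unfolding mdvd_expo_iff by (rule monomial_nonzeroE)
  then have "mentry qs ps r c \<in> ideal_gen (mon ` range expo)"
    by (auto simp: mem_monomial_ideal_iff mentry_def)
  then show ?thesis by (simp add: image_image var_eq_mon)
qed (simp add: mentry_def ideal_gen_zero)

lemma minimal_resolution_exists:
  fixes I :: "('n::{finite,linorder}, 'k::field) mpoly set"
  assumes "monomial_ideal I"
  shows "\<exists>d g \<phi>. minimal_graded_free_resolution (*) I (\<lambda>d. {f \<in> I. homogeneous d f}) d g \<phi>"
proof -
  obtain A where A: "I = ideal_gen (mon ` A)" using assms by (auto simp: monomial_ideal_def)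
  obtain as where as: "distinct as" "set as = minimal_monomials A"
    using finite_distinct_list[OF finite_minimal_monomials] by blast
  have I: "I = ideal_gen (mon ` set as)"
    using A as(2) by (simp add: ideal_gen_minimal_monomials)
  \<comment> \<open>The augmentation is a map to the free module of rank one with a basis element of
    multidegree zero.\<close>
  define qs :: "('n, 'k) mgens" where "qs = [(0, \<lambda>_. 0)]"
  define ps :: "('n, 'k) mgens" where "ps = map (\<lambda>a. (a, \<lambda>r. if r = 0 then 1 else 0)) as"
  define st where "st = resolution_gens ps"
  define d where "d i = map (int \<circ> mdeg \<circ> fst) (st i)" for i
  define g :: "('n, 'k) mpoly list" where "g = map mon as"
  define \<phi> where "\<phi> i = mat (length (st i)) (length (st (Suc i)))
    (\<lambda>(r, c). mentry (st i) (st (Suc i)) r c)" for i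
  have length_as: "length g = length as" "length ps = length as"
    by (simp_all add: g_def ps_def)
  have st0: "st 0 = ps" by (simp add: st_def)
  have nxt: "next_gens (st i) (st (Suc i))" for i
    unfolding st_def by (rule next_gens_resolution_gens)
  have comp0: "mcompatible qs ps"
    by (auto simp: mcompatible_def qs_def ps_def split: if_splits)
  \<comment> \<open>In a relation with an entry of degree zero, the multidegrees of all other entries divide the
    multidegree of that one; distinct minimal monomials do not divide each other, so this entry is
    the only one, and it vanishes.\<close>
  have min0: "minimal_gens ps"
    unfolding minimal_gens_def
  proof (intro allI impI notI)
    fix b u j assume u: "mrelation ps b u" "u j \<noteq> 0" "fst (ps ! j) = b"
    then have j: "j < length as" by (auto simp: mrelation_def ps_def)
    have "i = j" if "u i \<noteq> 0" for i
    proof -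
      have i: "i < length as" "mdvd (as ! i) (as ! j)"
        using u that j by (auto simp: mrelation_def ps_def)
      then have "as ! i = as ! j"
        using as(2) nth_mem[OF i(1)] nth_mem[OF j] by (simp add: minimal_monomials_def)
      then show ?thesis using as(1) i j by (simp add: nth_eq_iff_index_eq)
    qed
    then have "(\<Sum>i<length ps. u i * snd (ps ! i) 0) = (\<Sum>i<length ps. if i = j then u j else 0)"
      by (intro sum.cong) (auto simp: ps_def)
    also have "\<dots> = u j" using j by (simp add: length_as)
    finally show False using u(1,2) by (simp add: mrelation_def)
  qed
  have min: "minimal_gens (st i)" for i
    using min0 nxt by (cases i) (auto simp: st0 next_gens_def)
  have entry0: "mentry qs ps 0 c = g ! c" if "c < length as" for c
    using that by (simp add: mentry_def qs_def ps_def g_def mon_def)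
  have len: "length (d i) = length (st i)" "length g = length (st 0)" for i
    by (simp_all add: d_def g_def st0 ps_def)
  have carrier: "\<phi> i \<in> carrier_mat (length (st i)) (length (st (Suc i)))" for i
    by (simp add: \<phi>_def)
  have \<phi>: "\<phi> i $$ (r, c) = mentry (st i) (st (Suc i)) r c"
    if "r < length (st i)" "c < length (st (Suc i))" for i r c
    using that by (simp add: \<phi>_def)
  have "minimal_graded_free_resolution (*) I (\<lambda>d. {f \<in> I. homogeneous d f}) d g \<phi>"
    unfolding minimal_graded_free_resolution_def graded_free_resolution_def len One_nat_def
  proof (intro conjI allI impI)
    fix k assume k: "k < length (st 0)"
    then show "g ! k \<in> {f \<in> I. homogeneous (d 0 ! k) f}"
      by (auto simp: I g_def d_def st0 ps_def homogeneous_def intro!: ideal_gen_base)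
  next
    fix i r c assume rc: "r < length (st i)" "c < length (st (Suc i))"
    then show "homogeneous (d (Suc i) ! c - d i ! r) (\<phi> i $$ (r, c))"
      using homogeneous_mentry[OF next_gens_mcompatible[OF nxt] rc(2)] by (simp add: \<phi> d_def)
    show "\<phi> i $$ (r, c) \<in> ideal_gen (range var)"
      using mentry_mem_irrelevant[OF min nxt rc(2)] rc by (simp add: \<phi>)
  next
    have "augmentation (*) g ` carrier_vec (length (st 0)) =
        range (\<lambda>v. \<Sum>k<length as. mon (as ! k) * v k)"
      unfolding carrier_vec_eq_vec image_image len(2)[symmetric] augmentation_vec
      by (simp add: g_def)
    also have "\<dots> = I"
    proof (intro equalityI subsetI)
      fix f :: "('n, 'k) mpoly" assume "f \<in> range (\<lambda>v. \<Sum>k<length as. mon (as ! k) * v k)"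
      then obtain v where f: "f = (\<Sum>k<length as. v k * mon (as ! k))"
        by (auto simp: mult.commute)
      show "f \<in> I" unfolding I f
        by (intro ideal_gen_sum ideal_gen_scale ideal_gen_base imageI) simp
    next
      fix f assume "f \<in> I"
      then obtain u where "f = (\<Sum>p\<in>mon ` set as. u p * p)"
        unfolding I by (subst (asm) ideal_gen_finite) auto
      also have "\<dots> = (\<Sum>a\<in>set as. u (mon a) * mon a)"
        by (subst sum.reindex) (simp_all add: inj_on_def)
      also have "\<dots> = (\<Sum>k<length as. mon (as ! k) * u (mon (as ! k)))"
        by (subst sum.reindex_bij_betw[OF bij_betw_nth[OF as(1) refl refl], symmetric])
          (simp add: mult.commute)
      finally show "f \<in> range (\<lambda>v. \<Sum>k<length as. mon (as ! k) * v k)" by auto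
    qed
    finally show "augmentation (*) g ` carrier_vec (length (st 0)) = I" .
  next
    have "vec (length (st 0)) v \<in> (\<lambda>w. \<phi> 0 *\<^sub>v w) ` carrier_vec (length (st (Suc 0))) \<longleftrightarrow>
        augmentation (*) g (vec (length (st 0)) v) = 0" for v
    proof -
      have "(\<Sum>c<length ps. mentry qs ps 0 c * v c) = augmentation (*) g (vec (length (st 0)) v)"
        using augmentation_vec[of g v] entry0 by (simp add: st0 length_as)
      then show ?thesis
        using mentry_exact[OF comp0 nxt[of 0, unfolded st0], of v]
          vec_mem_image_mat_iff[OF carrier[of 0], of v]
        by (simp add: \<phi> st0 qs_def)
    qed
    then show "(\<lambda>w. \<phi> 0 *\<^sub>v w) ` carrier_vec (length (st (Suc 0))) =
        {v \<in> carrier_vec (length (st 0)). augmentation (*) g v = 0}"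
      using carrier[of 0] by (intro carrier_vec_Collect_eqI) auto
  next
    fix i
    have "vec (length (st (Suc i))) v \<in>
        (\<lambda>w. \<phi> (Suc i) *\<^sub>v w) ` carrier_vec (length (st (Suc (Suc i)))) \<longleftrightarrow>
        \<phi> i *\<^sub>v vec (length (st (Suc i))) v = 0\<^sub>v (length (st i))" for v
      using mentry_exact[OF next_gens_mcompatible[OF nxt] nxt, of i v]
        vec_mem_image_mat_iff[OF carrier[of "Suc i"], of v]
        mult_mat_vec_eq_zero_iff[OF carrier[of i], of v]
      by (simp add: \<phi>)
    then show "(\<lambda>w. \<phi> (Suc i) *\<^sub>v w) ` carrier_vec (length (st (Suc (Suc i)))) =
        {v \<in> carrier_vec (length (st (Suc i))). \<phi> i *\<^sub>v v = 0\<^sub>v (length (st i))}"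
      using carrier[of "Suc i"] by (intro carrier_vec_Collect_eqI) auto
  qed (simp_all add: len carrier)
  then show ?thesis by blast
qed

text \<open>The resolution that the Betti numbers of \<open>I\<close> refer to satisfies the degree bounds.\<close>

lemma ideal_reg_resolution:
  fixes I :: "('n::{finite,linorder}, 'k::field) mpoly set"
  assumes "monomial_ideal I" and e: "ereal (real_of_int e) \<ge> ideal_reg I"
  shows "\<exists>d g \<phi>. graded_free_resolution (*) I (\<lambda>d. {f \<in> I. homogeneous d f}) d g \<phi> \<and>
    (\<forall>i. \<forall>x\<in>set (d i). x \<le> e + int i)"
proof -
  let ?gr = "\<lambda>d. {f \<in> I. homogeneous d f}"
  define d where "d = (SOME d. \<exists>g \<phi>. minimal_graded_free_resolution (*) I ?gr d g \<phi>)"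
  obtain g \<phi> where res: "minimal_graded_free_resolution (*) I ?gr d g \<phi>"
    using someI_ex[OF minimal_resolution_exists[OF assms(1)]] unfolding d_def by blast
  have "x \<le> e + int i" if "x \<in> set (d i)" for i x
  proof -
    have "betti (*) I ?gr i x \<noteq> 0"
      using that unfolding betti_def d_def[symmetric] by (simp add: count_list_0_iff)
    then have "ereal (real_of_int (x - int i)) \<le> ideal_reg I"
      unfolding ideal_reg_def reg_def by (intro Sup_upper) blast
    then have "ereal (real_of_int (x - int i)) \<le> ereal (real_of_int e)"
      using e by (rule order_trans)
    then show ?thesis by simp
  qed
  then show ?thesis using res unfolding minimal_graded_free_resolution_def by blast
qed

section \<open>Ideals of Borel type\<close>

lemma mon_mem_truncation_iff:
  fixes I :: "('n::finite, 'k::field) mpoly set"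
  assumes "monomial_ideal I"
  shows "mon a \<in> truncation I e \<longleftrightarrow> mon a \<in> I \<and> e \<le> int (mdeg a)"
proof -
  have "truncation I e = ideal_gen (mon ` {a. mon a \<in> I \<and> e \<le> int (mdeg a)})"
    unfolding truncation_def by (rule arg_cong[of _ _ ideal_gen]) blast
  then have "mon a \<in> truncation I e \<longleftrightarrow> (\<exists>b. mon b \<in> I \<and> e \<le> int (mdeg b) \<and> mdvd b a)"
    by (auto simp: mon_mem_monomial_ideal_iff)
  also have "\<dots> \<longleftrightarrow> mon a \<in> I \<and> e \<le> int (mdeg a)"
  proof
    assume "\<exists>b. mon b \<in> I \<and> e \<le> int (mdeg b) \<and> mdvd b a"
    then obtain b where "mon b \<in> I" "e \<le> int (mdeg b)" "mdvd b a" by blast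
    then show "mon a \<in> I \<and> e \<le> int (mdeg a)"
      using monomial_ideal_mon_mdvd[OF assms] mdvd_mdeg_le[of b a] by force
  qed (use mdvd_refl in blast)
  finally show ?thesis .
qed

lemma monomial_ideal_truncation: "monomial_ideal (truncation I e)"
  unfolding monomial_ideal_def truncation_def
  by (rule exI[of _ "{a. mon a \<in> I \<and> e \<le> int (mdeg a)}"], rule arg_cong[of _ _ ideal_gen]) blast

lemma mon_mem_ideal_power:
  fixes p :: "('n::finite) monomial"
  assumes "keys p \<subseteq> V" "k \<le> mdeg p"
  shows "(mon p :: ('n, 'k::field) mpoly) \<in> ideal_power (ideal_gen (var ` V)) k"
  using assms
proof (induction k arbitrary: p)
  case (Suc k)
  then have "p \<noteq> 0" by auto
  then obtain i where i: "0 < lookup p i" by (rule monomial_nonzeroE)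
  then obtain q where q: "p = expo i + q"
    using mdvd_expo_iff by (metis mdvd_def)
  have "i \<in> V" "keys q \<subseteq> V" "k \<le> mdeg q"
    using Suc.prems i by (auto simp: q mdeg_add in_keys_iff lookup_add)
  then have "mon p \<in> {a * b | a b. a \<in> ideal_gen (var ` V) \<and>
      b \<in> ideal_power (ideal_gen (var ` V) :: ('n, 'k) mpoly set) k}"
    using Suc.IH[of q] unfolding q mon_mult[symmetric] var_eq_mon[symmetric]
    by (blast intro: ideal_gen_base)
  then show ?case by (simp add: ideal_gen_base)
qed simp

lemma mem_saturation_var:
  fixes f :: "('n, 'k::field) mpoly"
  assumes I: "monomial_ideal I" and f: "f * var m \<in> I"
  shows "f \<in> saturation I (ideal_gen {var m})"
proof -
  obtain A where A: "I = ideal_gen (mon ` A)" using I by (auto simp: monomial_ideal_def)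
  have gen: "f * g \<in> I" if "g \<in> ideal_gen {var m}" for g
    using that
  proof (induction rule: ideal_gen_induct)
    case (step c x y)
    then have "f * (c * x + y) = c * (f * var m) + f * y" by (simp add: algebra_simps)
    then show ?case using step f A by (simp add: ideal_gen_add ideal_gen_scale)
  qed (simp add: A ideal_gen_zero)
  have *: "f * (a * b) \<in> I" if "a \<in> ideal_gen {var m}" for a b
  proof -
    have "b * (f * a) \<in> I" using gen[OF that] unfolding A by (rule ideal_gen_scale)
    then show ?thesis by (simp add: ac_simps)
  qed
  have "f * g \<in> I" if "g \<in> ideal_power (ideal_gen {var m}) (Suc 0)" for g
    using that unfolding ideal_power.simps
  proof (induction rule: ideal_gen_induct)
    case (step c x y)
    then have "f * x \<in> I" using * by auto
    moreover have "f * (c * x + y) = c * (f * x) + f * y" by (simp add: algebra_simps)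
    ultimately show ?case using step A by (simp add: ideal_gen_add ideal_gen_scale)
  qed (simp add: A ideal_gen_zero)
  then show ?thesis unfolding saturation_def colon_def by blast
qed

text \<open>Here \<open>P a\<close> stands for \<open>x\<^sup>a \<notin> I\<close>: if all multiples of \<open>x\<^sup>a\<close> by monomials of large degree in
  the variables \<open>V\<close> are in \<open>I\<close>, then a multiple of maximal degree outside of \<open>I\<close> is a socle element
  with respect to these variables.\<close>

lemma socle_multiple_exists:
  fixes a :: "('n::finite) monomial"
  assumes "P a" "keys a \<subseteq> V"
    and bound: "\<And>p. keys p \<subseteq> V \<Longrightarrow> P (a + p) \<Longrightarrow> mdeg p < k"
  shows "\<exists>b. P b \<and> keys b \<subseteq> V \<and> mdeg a \<le> mdeg b \<and> (\<forall>j\<in>V. \<not> P (expo j + b))"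
proof -
  define Q where "Q p \<longleftrightarrow> keys p \<subseteq> V \<and> P (a + p)" for p
  have "Q 0" using assms(1) by (simp add: Q_def)
  moreover have "\<forall>p. Q p \<longrightarrow> mdeg p < k"
    using bound by (simp add: Q_def)
  ultimately have "\<exists>p. Q p \<and> (\<forall>q. Q q \<longrightarrow> mdeg q \<le> mdeg p)"
    by (rule ex_has_greatest_nat)
  then obtain p where p: "Q p" "\<And>q. Q q \<Longrightarrow> mdeg q \<le> mdeg p" by auto
  have "\<not> P (expo j + (a + p))" if "j \<in> V" for j
  proof
    assume P: "P (expo j + (a + p))"
    have "keys (expo j + p) \<subseteq> V"
      using p(1) that keys_add[of "expo j" p] by (auto simp: Q_def)
    with P have "Q (expo j + p)" by (simp add: Q_def ac_simps)
    from p(2)[OF this] show False by (simp add: mdeg_add)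
  qed
  moreover have "keys (a + p) \<subseteq> V" using assms(2) p(1) keys_add[of a p] by (auto simp: Q_def)
  ultimately show ?thesis using p(1) by (intro exI[of _ "a + p"]) (auto simp: Q_def mdeg_add)
qed

theorem theorem1p2p10:
  fixes I :: "('n::{finite,linorder}, 'k::field) mpoly set" and e :: int
  assumes "infinite (UNIV :: 'k set)"
    and "CARD('n) \<ge> 2"
    and "borel_type I"
    and "ereal (real_of_int e) \<ge> ideal_reg I"
  shows "stable (truncation I e)"
  unfolding stable_def
proof (intro conjI allI impI)
  have I: "monomial_ideal I" using assms(3) by (simp add: borel_type_def)
  show "monomial_ideal (truncation I e)" by (rule monomial_ideal_truncation)
  fix a :: "'n monomial" and j
  assume "a \<noteq> 0" and a: "mon a \<in> truncation I e" and j: "j < max_var a"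
  define m where "m = max_var a"
  define c where "c = a - expo m"
  define b where "b = expo j + c"
  have a_I: "mon a \<in> I" and a_deg: "e \<le> int (mdeg a)"
    using a mon_mem_truncation_iff[OF I] by blast+
  have "keys a \<noteq> {}" using \<open>a \<noteq> 0\<close> by (metis monomial_nonzeroE in_keys_iff empty_iff neq0_conv)
  then have m: "m \<in> keys a" "\<And>i. i \<in> keys a \<Longrightarrow> i \<le> m"
    unfolding m_def max_var_def by simp_all
  then have ac: "a = c + expo m"
    using mdvd_minus_add[of "expo m" a] by (simp add: c_def mdvd_expo_iff in_keys_iff add.commute)
  have b_deg: "mdeg b = mdeg a" by (simp add: b_def ac mdeg_add)
  have b_keys: "keys b \<subseteq> {..m}"
  proof -
    have "keys c \<subseteq> keys a" by (auto simp: ac in_keys_iff lookup_add)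
    then show ?thesis
      using m(2) j keys_add[of "expo j" c] by (fastforce simp: b_def m_def)
  qed
  have "mon b \<in> I"
  proof (rule ccontr)
    assume b_I: "mon b \<notin> I"
    have "mon c \<in> saturation I (ideal_gen {var m})"
      using a_I by (intro mem_saturation_var[OF I]) (simp add: ac var_eq_mon mon_mult)
    then have "mon c \<in> saturation I (ideal_gen (var ` {..m}))"
      using assms(3) by (simp add: borel_type_def)
    then obtain k where k: "\<And>g. g \<in> ideal_power (ideal_gen (var ` {..m})) k \<Longrightarrow> mon c * g \<in> I"
      by (auto simp: saturation_def colon_def)
    have "mdeg p < k" if "keys p \<subseteq> {..m}" "mon (b + p) \<notin> I" for p
    proof (rule ccontr)
      assume "\<not> ?thesis"
      then have "mon c * mon p \<in> I" using that(1) by (intro k mon_mem_ideal_power) simp_all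
      then have "mon (b + p) \<in> I"
        using monomial_ideal_mon_mdvd[OF I, of "c + p" "b + p"]
        by (simp add: mon_mult b_def mdvd_iff lookup_add)
      then show False using that(2) by simp
    qed
    then obtain w where w: "mon w \<notin> I" "keys w \<subseteq> {..m}" "mdeg b \<le> mdeg w"
      "\<And>i. i \<le> m \<Longrightarrow> mon (expo i + w) \<in> I"
      using socle_multiple_exists[of "\<lambda>b. mon b \<notin> I" b "{..m}" k] b_I b_keys by auto
    obtain d g \<phi> where res: "graded_free_resolution (*) I (\<lambda>d. {f \<in> I. homogeneous d f}) d g \<phi>"
      and d: "\<And>i x. x \<in> set (d i) \<Longrightarrow> x \<le> e + int i"
      using ideal_reg_resolution[OF I assms(4)] by blast
    have "card {..m} \<noteq> 0" by (auto simp: card_eq_0_iff)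
    then obtain i where i: "card {..m} = Suc i" using not0_implies_Suc by blast
    obtain x where "x \<in> set (d i)" "int (mdeg w) + int (Suc i) \<le> x"
      using resolution_degree_ge_socle[OF res I w(1,2) _ i] w(4) by auto
    then show False using d[of x i] a_deg b_deg w(3) by simp
  qed
  then show "mon (single j 1 + (a - single (max_var a) 1)) \<in> truncation I e"
    using mon_mem_truncation_iff[OF I] a_deg b_deg by (simp add: b_def c_def m_def expo_def)
qed

end
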